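(* Fix $\gamma\in(0,1]$ and consider a weak solution $(f_t)_{t\ge0}$ to the Landau equation with parameter $\gamma$. There are constants $a>0$ and $C>0$, both depending only on $\gamma$ and $m_2(f_0)$, such that $$\int_{\mathbb R^3}e^{a|v|^2}f_t(\mathrm dv)\le C\exp\big[C t^{-2/\gamma}\big]\qquad\text{for all } t>0.$$
   Context: For $q>0$ and a probability measure $f$ on $\mathbb R^3$, $m_q(f)=\int_{\mathbb R^3}|v|^q f(\mathrm dv)$. Landau equation: for $\gamma\in(0,1]$ and $x\in\mathbb R^3$ let $\mathbf a(x)=|x|^{2+\gamma}\big(\mathbf I_3-\frac{xx^*}{|x|^2}\big)$ (with $\mathbf a(0)=0$) and $b(x)=-2|x|^\gamma x$. For $\varphi\in C^2_b(\mathbb R^3)$ (bounded $C^2$ with bounded derivatives up to order 2) put $$\mathcal L\varphi(v,v_* )=\tfrac12\sum_{k,\ell=1}^3 \mathbf a_{k\ell}(v-v_* )\partial^2_{k\ell}\varphi(v)+\sum_{k=1}^3 b_k(v-v_* )\partial_k\varphi(v).$$ A weak solution to the Landau equation is a family $(f_t)_{t\ge0}$ of probability measures on $\mathbb R^3$ such that $\sup_{t\in[0,T]}m_2(f_t)+\int_0^T m_{2+\gamma}(f_t)\,\mathrm dt<\infty$ for all $T>0$, $m_2(f_t)\le m_2(f_0)$ for all $t\ge0$, and for all $\varphi\in C^2_b(\mathbb R^3)$ and $t\ge0$, $$\int_{\mathbb R^3}\varphi(v)f_t(\mathrm dv)=\int_{\mathbb R^3}\varphi(v)f_0(\mathrm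 dv)+\int_0^t\int_{\mathbb R^3}\int_{\mathbb R^3}\mathcal L\varphi(v,v_* )f_s(\mathrm dv_* )f_s(\mathrm dv)\,\mathrm ds.$$ *)

theory Defs
  imports "HOL-Analysis.Analysis" "HOL-Probability.Probability"
begin

text \<open>
  Moments are nonnegative extended integrals, so that an infinite moment is really infinite.
\<close>

definition moment :: "real \<Rightarrow> (real^3) measure \<Rightarrow> ennreal" where
  "moment q f = (\<integral>\<^sup>+v. ennreal (norm v powr q) \<partial>f)"

definition partial_deriv :: "3 \<Rightarrow> (real^3 \<Rightarrow> real) \<Rightarrow> real^3 \<Rightarrow> real" where
  "partial_deriv k \<phi> v = frechet_derivative \<phi> (at v) (axis k 1)"

definition C2b :: "(real^3 \<Rightarrow> real) set" where
  "C2b = {\<phi>.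
     (\<forall>v. \<phi> differentiable (at v)) \<and>
     (\<forall>k v. partial_deriv k \<phi> differentiable (at v)) \<and>
     (\<forall>k l. continuous_on UNIV (partial_deriv k (partial_deriv l \<phi>))) \<and>
     bounded (range \<phi>) \<and>
     (\<forall>k. bounded (range (partial_deriv k \<phi>))) \<and>
     (\<forall>k l. bounded (range (partial_deriv k (partial_deriv l \<phi>))))}"

text \<open>
  At \<open>x = 0\<close> the matrix below is \<open>0\<close>, because \<open>0 powr (2 + \<gamma>) = 0\<close>.
\<close>

definition landau_a :: "real \<Rightarrow> real^3 \<Rightarrow> real^3^3" where
  "landau_a \<gamma> x =
     norm x powr (2 + \<gamma>) *\<^sub>R (mat 1 - (1 / (norm x)\<^sup>2) *\<^sub>R (\<chi> k l. x $ k * x $ l))"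

definition landau_b :: "real \<Rightarrow> real^3 \<Rightarrow> real^3" where
  "landau_b \<gamma> x = (- 2 * norm x powr \<gamma>) *\<^sub>R x"

definition landau_L :: "real \<Rightarrow> (real^3 \<Rightarrow> real) \<Rightarrow> real^3 \<Rightarrow> real^3 \<Rightarrow> real" where
  "landau_L \<gamma> \<phi> v w =
     1 / 2 * (\<Sum>k\<in>UNIV. \<Sum>l\<in>UNIV.
        landau_a \<gamma> (v - w) $ k $ l * partial_deriv k (partial_deriv l \<phi>) v)
     + (\<Sum>k\<in>UNIV. landau_b \<gamma> (v - w) $ k * partial_deriv k \<phi> v)"

definition landau_weak_rhs ::
  "real \<Rightarrow> (real^3 \<Rightarrow> real) \<Rightarrow> (real^3) measure \<Rightarrow> real" where
  "landau_weak_rhs \<gamma> \<phi> f = (\<integral>v. (\<integral>w. landau_L \<gamma> \<phi> v w \<partial>f) \<partial>f)"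

text \<open>
  Only the values \<open>f t\<close> with \<open>t \<ge> 0\<close> matter. The Bochner integral of a non-integrable function
  is \<open>0\<close> by convention, so the existence of the time integral in the weak equation is made
  explicit. No such clause is needed for the integrals in \<open>v\<close> and \<open>w\<close>: the function
  \<open>landau_L \<gamma> \<phi>\<close> is bounded by a multiple of \<open>1 + norm v powr (2 + \<gamma>) + norm w powr (2 + \<gamma>)\<close>,
  hence integrable for almost every \<open>s\<close> by the moment condition. Measurability of
  \<open>t \<mapsto> f t\<close> is not assumed either: the weak equation makes \<open>t \<mapsto> \<integral>v. \<phi> v \<partial>f t\<close> continuous on
  \<open>[0, \<infinity>)\<close> for every \<open>\<phi>\<close> in \<open>C2b\<close>.
\<close>

definition landau_weak_solution :: "real \<Rightarrow> (real \<Rightarrow> (real^3) measure) \<Rightarrow> bool" where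
  "landau_weak_solution \<gamma> f \<longleftrightarrow>
     (\<forall>t\<ge>0. prob_space (f t) \<and> sets (f t) = sets borel) \<and>
     (\<forall>T>0. (SUP t\<in>{0..T}. moment 2 (f t))
        + (\<integral>\<^sup>+t\<in>{0..T}. moment (2 + \<gamma>) (f t) \<partial>lborel) < \<infinity>) \<and>
     (\<forall>t\<ge>0. moment 2 (f t) \<le> moment 2 (f 0)) \<and>
     (\<forall>\<phi>\<in>C2b. \<forall>t\<ge>0.
        set_integrable lborel {0..t} (\<lambda>s. landau_weak_rhs \<gamma> \<phi> (f s)) \<and>
        (\<integral>v. \<phi> v \<partial>f t) =
          (\<integral>v. \<phi> v \<partial>f 0) + (LINT s:{0..t}|lborel. landau_weak_rhs \<gamma> \<phi> (f s)))"

end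

(*
  Test the equation with exponential moments whose rate grows in time. For a radial test function
  h(|v|^2) the symmetrised generator contains the good term
  -|v - w|^gamma (h'(x) - h'(y)) (x - y) with x = |v|^2 and y = |w|^2, and at least half of the mass
  lies in a ball whose radius is controlled by the energy. Hence the collisions dissipate the
  integral of x^(1 + gamma/2) h'(x) for large x. With h(x) = exp (alpha(t) x), the factor
  x^(gamma/2) absorbs the growth term alpha'(t) x exp (alpha(t) x) as soon as
  x^(gamma/2) >= 32 alpha'(t)/alpha(t), while smaller x contribute a bounded amount when
  alpha(t) is proportional to t^(2/gamma). The exponential is replaced by ln (1 + eps exp)/eps,
  which grows linearly, so that only the second moment is needed, and eps tends to 0 at the end.
*)
theory Submission
  imports Defs "HOL-Real_Asymp.Real_Asymp"
begin

section \<open>Radial test functions\<close>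

text \<open>The obstacle is the second-order term 2 h2(x) (x y - (v . w)^2) of the generator: it is
  nonnegative and has the same order x^(1 + \<gamma>/2) h1(x) as the good term. For h(x) = exp (b x)
  it costs about b times the energy of the other particle, so it is beaten only when b times the
  total energy is small. This is why the final rate \<open>a\<close> is of order 1 /
  \<open>mass\<close>. The second obstacle is that the rate moves in time, while the weak equation
  accepts only fixed test functions and its right-hand side is merely integrable in time. A short
  increment is therefore split into a change of rate at a frozen time and an evolution at a frozen
  rate, and the resulting bound on right increments is integrated by a Dini argument. No exponential
  moment is available at the start: the rate begins at 0, where the regularised moment is at most 1.
  Large times are reached by restarting one unit of time earlier, since the energy never exceeds its
  initial value.\<close>

definition C2_radial :: "(real \<Rightarrow> real) \<Rightarrow> (real \<Rightarrow> real) \<Rightarrow> (real \<Rightarrow> real) \<Rightarrow> bool" where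
  "C2_radial h h1 h2 \<longleftrightarrow>
     (\<forall>r>-1. (h has_real_derivative h1 r) (at r)) \<and>
     (\<forall>r>-1. (h1 has_real_derivative h2 r) (at r)) \<and> continuous_on {-1<..} h2"

abbreviation (input) radial :: "(real \<Rightarrow> real) \<Rightarrow> real^3 \<Rightarrow> real" where
  "radial h v \<equiv> h (v \<bullet> v)"

lemma radial_has_derivative:
  fixes v :: "real^3"
  assumes "(h has_real_derivative h1 (v \<bullet> v)) (at (v \<bullet> v))"
  shows "(radial h has_derivative (\<lambda>u. 2 * (v \<bullet> u) * h1 (v \<bullet> v))) (at v)"
proof -
  have i: "((\<lambda>v::real^3. v \<bullet> v) has_derivative (\<lambda>u. 2 * (v \<bullet> u))) (at v)"
    by (auto intro!: derivative_eq_intros simp: inner_commute)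
  have "((h \<circ> (\<lambda>v. v \<bullet> v)) has_derivative ((*) (h1 (v \<bullet> v))) \<circ> (\<lambda>u. 2 * (v \<bullet> u))) (at v)"
    using assms by (intro diff_chain_at i) (simp add: has_field_derivative_def)
  then show ?thesis
    by (simp add: o_def mult_ac)
qed

text \<open>\<open>C2_radial\<close> asks for derivatives on all r > -1, so that the energy 0 of v =
  0 is an interior point and powers of 1 + r stay smooth.\<close>

lemma inner_self_gt_minus_one: "-1 < (v::real^3) \<bullet> v"
  using inner_ge_zero[of v] by linarith

lemma partial_deriv_radial:
  assumes "C2_radial h h1 h2"
  shows "partial_deriv k (radial h) = (\<lambda>v. 2 * v $ k * h1 (v \<bullet> v))"
proof
  fix v :: "real^3"
  have "(radial h has_derivative (\<lambda>u. 2 * (v \<bullet> u) * h1 (v \<bullet> v))) (at v)"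
    using assms inner_self_gt_minus_one by (intro radial_has_derivative) (auto simp: C2_radial_def)
  then have "frechet_derivative (radial h) (at v) = (\<lambda>u. 2 * (v \<bullet> u) * h1 (v \<bullet> v))"
    by (rule frechet_derivative_at[symmetric])
  then show "partial_deriv k (radial h) v = 2 * v $ k * h1 (v \<bullet> v)"
    unfolding partial_deriv_def by (simp add: inner_axis)
qed

lemma component_mult_radial_has_derivative:
  fixes v :: "real^3"
  assumes "C2_radial h h1 h2"
  shows "((\<lambda>v. 2 * v $ l * h1 (v \<bullet> v)) has_derivative
    (\<lambda>u. 2 * u $ l * h1 (v \<bullet> v) + 4 * v $ l * (v \<bullet> u) * h2 (v \<bullet> v))) (at v)"
proof -
  have d: "(radial h1 has_derivative (\<lambda>u. 2 * (v \<bullet> u) * h2 (v \<bullet> v))) (at v)"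
    using assms inner_self_gt_minus_one by (intro radial_has_derivative) (auto simp: C2_radial_def)
  have e: "((\<lambda>v::real^3. 2 * v $ l) has_derivative (\<lambda>u. 2 * u $ l)) (at v)"
    by (intro bounded_linear_imp_has_derivative bounded_linear_const_mult bounded_linear_vec_nth)
  show ?thesis
    using has_derivative_mult[OF e d] by (simp add: algebra_simps)
qed

lemma partial_deriv2_radial:
  assumes "C2_radial h h1 h2"
  shows "partial_deriv k (partial_deriv l (radial h)) =
    (\<lambda>v. (if k = l then 2 * h1 (v \<bullet> v) else 0) + 4 * v $ k * v $ l * h2 (v \<bullet> v))"
proof
  fix v :: "real^3"
  show "partial_deriv k (partial_deriv l (radial h)) v =
    (if k = l then 2 * h1 (v \<bullet> v) else 0) + 4 * v $ k * v $ l * h2 (v \<bullet> v)"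
    unfolding partial_deriv_radial[OF assms]
    unfolding partial_deriv_def
    unfolding frechet_derivative_at[OF component_mult_radial_has_derivative[OF assms], symmetric]
    by (simp add: inner_axis) (simp add: axis_def)
qed

lemma abs_component_le: "\<bar>v $ k\<bar> * \<bar>v $ l\<bar> \<le> (v::real^3) \<bullet> v"
  using mult_mono[OF component_le_norm_cart[of v k] component_le_norm_cart[of v l]]
  by (simp add: norm_eq_sqrt_inner)

lemma two_abs_component_le: "2 * \<bar>v $ k\<bar> \<le> 1 + (v::real^3) \<bullet> v"
proof -
  have "0 \<le> (\<bar>v $ k\<bar> - 1)\<^sup>2"
    by simp
  then have "2 * \<bar>v $ k\<bar> \<le> 1 + \<bar>v $ k\<bar> * \<bar>v $ k\<bar>"
    by (simp add: power2_eq_square algebra_simps)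
  then show ?thesis
    using abs_component_le[of v k k] by linarith
qed

text \<open>The factor 1 + r pays for the components of v produced by the chain rule: one in the
  gradient, two in the Hessian.\<close>

lemma radial_in_C2b:
  assumes h: "C2_radial h h1 h2"
    and b0: "\<And>r. 0 \<le> r \<Longrightarrow> \<bar>h r\<bar> \<le> C"
    and b1: "\<And>r. 0 \<le> r \<Longrightarrow> (1 + r) * \<bar>h1 r\<bar> \<le> C"
    and b2: "\<And>r. 0 \<le> r \<Longrightarrow> (1 + r) * \<bar>h2 r\<bar> \<le> C"
  shows "radial h \<in> C2b"
proof -
  have "radial h differentiable at v" for v
    using h inner_self_gt_minus_one[of v] radial_has_derivative[of h h1 v]
    by (auto simp: C2_radial_def intro: differentiableI)
  moreover have "partial_deriv k (radial h) differentiable at v" for k v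
    unfolding partial_deriv_radial[OF h]
    by (rule differentiableI) (rule component_mult_radial_has_derivative[OF h])
  moreover have "continuous_on UNIV (partial_deriv k (partial_deriv l (radial h)))" for k l
  proof -
    have c1: "continuous_on {-1<..} h1"
      using h by (auto simp: C2_radial_def intro!: continuous_at_imp_continuous_on DERIV_isCont)
    have c2: "continuous_on {-1<..} h2"
      using h by (simp add: C2_radial_def)
    have "continuous_on UNIV (\<lambda>v::real^3. h1 (v \<bullet> v))" "continuous_on UNIV (\<lambda>v::real^3. h2 (v \<bullet> v))"
      using inner_self_gt_minus_one
      by (auto intro!: continuous_on_compose2[OF c1] continuous_on_compose2[OF c2] continuous_intros)
    then show ?thesis
      unfolding partial_deriv2_radial[OF h] by (cases "k = l") (auto intro!: continuous_intros)
  qed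
  moreover have "bounded (range (radial h))"
    unfolding bounded_iff using b0 by (intro exI[of _ C]) auto
  moreover have "bounded (range (partial_deriv k (radial h)))" for k
    unfolding partial_deriv_radial[OF h] bounded_iff
  proof (intro exI ballI, elim rangeE)
    fix x and v :: "real^3" assume "x = 2 * v $ k * h1 (v \<bullet> v)"
    moreover have "2 * \<bar>v $ k\<bar> * \<bar>h1 (v \<bullet> v)\<bar> \<le> (1 + v \<bullet> v) * \<bar>h1 (v \<bullet> v)\<bar>"
      by (intro mult_right_mono two_abs_component_le) auto
    ultimately show "norm x \<le> C"
      using b1[of "v \<bullet> v"] by (simp add: abs_mult)
  qed
  moreover have "bounded (range (partial_deriv k (partial_deriv l (radial h))))" for k l
    unfolding partial_deriv2_radial[OF h] bounded_iff
  proof (intro exI ballI, elim rangeE)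
    fix x and v :: "real^3"
    define X where "X = v \<bullet> v"
    have X: "0 \<le> X" by (simp add: X_def)
    assume x: "x = (if k = l then 2 * h1 (v \<bullet> v) else 0) + 4 * v $ k * v $ l * h2 (v \<bullet> v)"
    have "\<bar>v $ k\<bar> * \<bar>v $ l\<bar> * \<bar>h2 X\<bar> \<le> (1 + X) * \<bar>h2 X\<bar>"
      using abs_component_le[of v k l] by (intro mult_right_mono) (auto simp: X_def)
    then have "\<bar>4 * v $ k * v $ l * h2 X\<bar> \<le> 4 * C"
      using b2[OF X] by (simp add: abs_mult)
    moreover have "\<bar>h1 X\<bar> \<le> (1 + X) * \<bar>h1 X\<bar>"
      using X by (simp add: algebra_simps)
    then have "\<bar>if k = l then 2 * h1 X else 0\<bar> \<le> 2 * C"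
      using b1[OF X] by auto
    ultimately show "norm x \<le> 2 * C + 4 * C"
      unfolding x X_def[symmetric] real_norm_def by (intro order_trans[OF abs_triangle_ineq] add_mono)
  qed
  ultimately show ?thesis
    by (simp add: C2b_def)
qed

text \<open>Cancelling the squared norm gives a form without division, in which z = 0 is no longer
  special.\<close>

lemma landau_a_component:
  "landau_a \<gamma> z $ k $ l = norm z powr \<gamma> * ((if k = l then z \<bullet> z else 0) - z $ k * z $ l)"
proof (cases "z = 0")
  case True
  then show ?thesis by (simp add: landau_a_def)
next
  case False
  then have "norm z powr (2 + \<gamma>) = norm z powr \<gamma> * (norm z)\<^sup>2"
    by (simp add: powr_add)
  moreover have "z \<bullet> z = (norm z)\<^sup>2"
    by (simp add: power2_norm_eq_inner)
  ultimately show ?thesis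
    using False by (simp add: landau_a_def mat_def field_simps)
qed

text \<open>With z = v - w, the matrix is |z|^\<gamma> times |z|^2 I - z z^T. Its trace combines
  with the drift into |w|^2 - |v|^2. As the matrix annihilates z, its quadratic form at v is, up to
  |z|^\<gamma>, the Gram determinant of v and w.\<close>

lemma landau_L_radial:
  assumes h: "C2_radial h h1 h2"
  shows "landau_L \<gamma> (radial h) v w = norm (v - w) powr \<gamma> *
    (2 * h1 (v \<bullet> v) * (w \<bullet> w - v \<bullet> v) + 2 * h2 (v \<bullet> v) * ((v \<bullet> v) * (w \<bullet> w) - (v \<bullet> w)\<^sup>2))"
proof -
  define d where "d = norm (v - w) powr \<gamma>"
  define A where "A = h1 (v \<bullet> v)"
  define B where "B = h2 (v \<bullet> v)"
  have "landau_L \<gamma> (radial h) v w =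
     1 / 2 * (\<Sum>k\<in>UNIV. \<Sum>l\<in>UNIV.
        d * ((if k = l then (v - w) \<bullet> (v - w) else 0) - (v - w) $ k * (v - w) $ l) *
        ((if k = l then 2 * A else 0) + 4 * v $ k * v $ l * B))
     + (\<Sum>k\<in>UNIV. - 2 * d * (v - w) $ k * (2 * v $ k * A))"
    unfolding landau_L_def partial_deriv2_radial[OF h] landau_a_component
    unfolding partial_deriv_radial[OF h]
    unfolding d_def A_def B_def by (simp add: landau_b_def)
  also have "\<dots> = d * (2 * A * (w \<bullet> w - v \<bullet> v) + 2 * B * ((v \<bullet> v) * (w \<bullet> w) - (v \<bullet> w)\<^sup>2))"
    by (simp add: sum_3 inner_vec_def) algebra
  finally show ?thesis
    by (simp add: d_def A_def B_def)
qed

section \<open>Bounds on the generator\<close>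

lemma cross_term_bounds:
  fixes v w :: "'a::real_inner"
  shows "0 \<le> (v \<bullet> v) * (w \<bullet> w) - (v \<bullet> w)\<^sup>2" "(v \<bullet> v) * (w \<bullet> w) - (v \<bullet> w)\<^sup>2 \<le> (v \<bullet> v) * (w \<bullet> w)"
  using Cauchy_Schwarz_ineq[of v w] by auto

lemma inner_self_powr_half: "(v \<bullet> v) powr (q / 2) = norm v powr q"
  by (simp add: norm_eq_sqrt_inner powr_half_sqrt[symmetric] powr_powr)

lemma two_powr_le_two: "q \<le> 1 \<Longrightarrow> (2::real) powr q \<le> 2"
  using powr_mono[of q 1 "2::real"] by simp

lemma norm_diff_powr_le:
  fixes v w :: "'a::real_inner"
  assumes "0 < \<gamma>" "\<gamma> \<le> 1" "w \<bullet> w \<le> v \<bullet> v"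
  shows "norm (v - w) powr \<gamma> \<le> 2 * (v \<bullet> v) powr (\<gamma> / 2)"
proof -
  have "norm w \<le> norm v"
    using assms(3) by (simp add: norm_eq_sqrt_inner)
  then have "norm (v - w) \<le> 2 * norm v"
    using norm_triangle_ineq4[of v w] by linarith
  then have "norm (v - w) powr \<gamma> \<le> (2 * norm v) powr \<gamma>"
    using assms by (intro powr_mono2) auto
  also have "\<dots> = 2 powr \<gamma> * norm v powr \<gamma>"
    by (simp add: powr_mult)
  also have "\<dots> \<le> 2 * norm v powr \<gamma>"
    by (intro mult_right_mono two_powr_le_two assms) auto
  finally show ?thesis
    by (simp add: inner_self_powr_half)
qed

lemma norm_diff_powr_ge:
  fixes v w :: "'a::real_inner"
  assumes "0 < \<gamma>" "\<gamma> \<le> 1" "4 * (w \<bullet> w) \<le> v \<bullet> v"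
  shows "(v \<bullet> v) powr (\<gamma> / 2) \<le> 2 * norm (v - w) powr \<gamma>"
proof -
  have "sqrt (4 * (w \<bullet> w)) \<le> sqrt (v \<bullet> v)"
    using assms(3) by (rule real_sqrt_le_mono)
  then have "2 * norm w \<le> norm v"
    by (simp add: norm_eq_sqrt_inner real_sqrt_mult)
  then have "norm v \<le> 2 * norm (v - w)"
    using norm_triangle_ineq2[of v w] by linarith
  then have "norm v powr \<gamma> \<le> (2 * norm (v - w)) powr \<gamma>"
    using assms by (intro powr_mono2) auto
  also have "\<dots> = 2 powr \<gamma> * norm (v - w) powr \<gamma>"
    by (simp add: powr_mult)
  also have "\<dots> \<le> 2 * norm (v - w) powr \<gamma>"
    by (intro mult_right_mono two_powr_le_two assms) auto
  finally show ?thesis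
    by (simp add: inner_self_powr_half)
qed

text \<open>Comparable to 1 + |v|^(2 + \<gamma>), but smooth and at least 1, so that it serves both
  as a dominating function and as a limit of test functions.\<close>

definition weight :: "real \<Rightarrow> real^3 \<Rightarrow> real" where
  "weight \<gamma> v = (1 + v \<bullet> v) powr (1 + \<gamma> / 2)"

lemma weight_nonneg: "0 \<le> weight \<gamma> v"
  by (simp add: weight_def)

lemma inner_self_powr_le_weight: "0 < \<gamma> \<Longrightarrow> (v \<bullet> v) powr (1 + \<gamma> / 2) \<le> weight \<gamma> v"
  unfolding weight_def by (intro powr_mono2) auto

lemma inner_self_le_weight: "0 < \<gamma> \<Longrightarrow> 1 + v \<bullet> v \<le> weight \<gamma> v"
  unfolding weight_def using powr_mono[of 1 "1 + \<gamma> / 2" "1 + v \<bullet> v"] by simp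

text \<open>Everything is measured against the larger energy z = max x y. The decay of h2 absorbs
  one of the two energies in the Gram determinant, which is at most x y; the total order is then
  z^(1 + \<gamma>/2).\<close>

lemma abs_landau_L_radial_le:
  assumes \<gamma>: "0 < \<gamma>" "\<gamma> \<le> 1"
    and h: "C2_radial h h1 h2"
    and b1: "\<And>r. 0 \<le> r \<Longrightarrow> \<bar>h1 r\<bar> \<le> C"
    and b2: "\<And>r. 0 \<le> r \<Longrightarrow> (1 + r) * \<bar>h2 r\<bar> \<le> C"
  shows "\<bar>landau_L \<gamma> (radial h) v w\<bar> \<le> 8 * C * (weight \<gamma> v + weight \<gamma> w)"
proof -
  define x where "x = v \<bullet> v"
  define y where "y = w \<bullet> w"
  define Q where "Q = x * y - (v \<bullet> w)\<^sup>2"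
  define d where "d = norm (v - w) powr \<gamma>"
  define z where "z = max x y"
  have pos: "0 \<le> x" "0 \<le> y" "0 \<le> d" "0 \<le> z"
    by (auto simp: x_def y_def d_def z_def le_max_iff_disj)
  have C: "0 \<le> C"
    using b1[of 0] by simp
  have Q: "0 \<le> Q" "Q \<le> x * y"
    using cross_term_bounds[of v w] by (auto simp: x_def y_def Q_def)
  have d: "d \<le> 2 * z powr (\<gamma> / 2)"
  proof (cases "y \<le> x")
    case True
    then show ?thesis
      using norm_diff_powr_le[OF \<gamma>, of w v] by (auto simp: x_def y_def d_def z_def max_def)
  next
    case False
    then show ?thesis
      using norm_diff_powr_le[OF \<gamma>, of v w]
      by (auto simp: x_def y_def d_def z_def max_def norm_minus_commute)
  qed
  have "\<bar>h1 x * (y - x)\<bar> \<le> C * z"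
    unfolding abs_mult using b1[OF pos(1)] pos C by (intro mult_mono) (auto simp: z_def)
  moreover have "\<bar>h2 x * Q\<bar> \<le> C * z"
  proof -
    have "\<bar>h2 x * Q\<bar> \<le> \<bar>h2 x\<bar> * (x * y)"
      using Q by (simp add: abs_mult mult_left_mono)
    also have "\<dots> = (x * \<bar>h2 x\<bar>) * y"
      by simp
    also have "\<dots> \<le> C * z"
      using b2[OF pos(1)] pos C by (intro mult_mono) (auto simp: z_def algebra_simps)
    finally show ?thesis .
  qed
  ultimately have "\<bar>2 * h1 x * (y - x) + 2 * h2 x * Q\<bar> \<le> 4 * (C * z)"
    by linarith
  then have "d * \<bar>2 * h1 x * (y - x) + 2 * h2 x * Q\<bar> \<le> 2 * z powr (\<gamma> / 2) * (4 * (C * z))"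
    using d pos by (intro mult_mono) auto
  also have "\<dots> = 8 * C * z powr (1 + \<gamma> / 2)"
    unfolding powr_mult_base[OF pos(4), symmetric] by simp
  also have "\<dots> \<le> 8 * C * (weight \<gamma> v + weight \<gamma> w)"
    using inner_self_powr_le_weight[OF \<gamma>(1), of v] inner_self_powr_le_weight[OF \<gamma>(1), of w] C
      weight_nonneg[of \<gamma> v] weight_nonneg[of \<gamma> w]
    by (intro mult_left_mono) (auto simp: z_def max_def x_def y_def)
  finally show ?thesis
    using pos unfolding landau_L_radial[OF h] by (simp add: abs_mult x_def y_def Q_def d_def)
qed

text \<open>
  In the symmetrised generator a convex increasing \<open>h\<close> produces the good term
  \<open>- (h1 x - h1 y) * (x - y)\<close>; it is kept only where one of the energies is at least four times
  the other.
\<close>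

definition gain :: "real \<Rightarrow> (real \<Rightarrow> real) \<Rightarrow> real \<Rightarrow> real \<Rightarrow> real" where
  "gain \<gamma> h1 R x = (if 4 * R \<le> x then x powr (1 + \<gamma> / 2) * (h1 x - h1 R) else 0)"

text \<open>The factor |v - w|^\<gamma> is at most twice max(x, y)^(\<gamma>/2), so the extra power
  falls on the larger energy. Monotonicity of h1 moves h1 to that energy too, whence the two
  symmetric terms.\<close>

lemma cross_term_le:
  fixes v w :: "real^3"
  assumes \<gamma>: "0 < \<gamma>" "\<gamma> \<le> 1"
    and h1: "\<And>r. 0 \<le> r \<Longrightarrow> 0 \<le> h1 r" "\<And>r s. 0 \<le> r \<Longrightarrow> r \<le> s \<Longrightarrow> h1 r \<le> h1 s"
    and h2: "\<And>r. 0 \<le> r \<Longrightarrow> 0 \<le> h2 r" "\<And>r. 0 \<le> r \<Longrightarrow> h2 r \<le> b * h1 r"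
    and b: "0 \<le> b"
  shows "norm (v - w) powr \<gamma> * (2 * h2 (v \<bullet> v) * ((v \<bullet> v) * (w \<bullet> w) - (v \<bullet> w)\<^sup>2)) \<le>
    4 * b * (h1 (v \<bullet> v) * (v \<bullet> v) powr (1 + \<gamma> / 2) * (w \<bullet> w)
      + h1 (w \<bullet> w) * (w \<bullet> w) powr (1 + \<gamma> / 2) * (v \<bullet> v))"
proof -
  define x where "x = v \<bullet> v"
  define y where "y = w \<bullet> w"
  define Q where "Q = x * y - (v \<bullet> w)\<^sup>2"
  define d where "d = norm (v - w) powr \<gamma>"
  have pos: "0 \<le> x" "0 \<le> y" "0 \<le> d"
    by (auto simp: x_def y_def d_def)
  have Q: "0 \<le> Q" "Q \<le> x * y"
    using cross_term_bounds[of v w] by (auto simp: x_def y_def Q_def)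
  have "h2 x * Q \<le> (b * h1 x) * (x * y)"
    using pos h2 h1 b Q by (intro mult_mono) auto
  then have 1: "d * (2 * h2 x * Q) \<le> d * (2 * (b * h1 x * (x * y)))"
    using pos by (intro mult_left_mono) auto
  have sx: "x * x powr (\<gamma> / 2) = x powr (1 + \<gamma> / 2)" and sy: "y * y powr (\<gamma> / 2) = y powr (1 + \<gamma> / 2)"
    using pos by (auto simp: powr_mult_base)
  have nn: "0 \<le> h1 x * x powr (1 + \<gamma> / 2) * y" "0 \<le> h1 y * y powr (1 + \<gamma> / 2) * x"
    using pos h1 by auto
  have "d * (b * h1 x * (x * y)) \<le> 2 * b * (h1 x * x powr (1 + \<gamma> / 2) * y + h1 y * y powr (1 + \<gamma> / 2) * x)"
  proof (cases "y \<le> x")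
    case True
    then have "d \<le> 2 * x powr (\<gamma> / 2)"
      using norm_diff_powr_le[OF \<gamma>, of w v] by (auto simp: x_def y_def d_def)
    then have "d * (b * h1 x * (x * y)) \<le> (2 * x powr (\<gamma> / 2)) * (b * h1 x * (x * y))"
      using pos h1 b by (intro mult_right_mono) auto
    also have "\<dots> = 2 * b * (h1 x * (x * x powr (\<gamma> / 2)) * y)"
      by (simp add: algebra_simps)
    also have "\<dots> \<le> 2 * b * (h1 x * x powr (1 + \<gamma> / 2) * y + h1 y * y powr (1 + \<gamma> / 2) * x)"
      unfolding sx using nn b by (intro mult_left_mono) auto
    finally show ?thesis .
  next
    case False
    then have d: "d \<le> 2 * y powr (\<gamma> / 2)"
      using norm_diff_powr_le[OF \<gamma>, of v w] by (auto simp: x_def y_def d_def norm_minus_commute)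
    have "h1 x \<le> h1 y"
      using False pos h1 by auto
    then have "b * h1 x * (x * y) \<le> b * h1 y * (x * y)"
      using pos b by (intro mult_right_mono mult_left_mono) auto
    then have "d * (b * h1 x * (x * y)) \<le> (2 * y powr (\<gamma> / 2)) * (b * h1 y * (x * y))"
      using pos h1(1)[OF pos(1)] b by (intro mult_mono[OF d]) simp_all
    also have "\<dots> = 2 * b * (h1 y * (y * y powr (\<gamma> / 2)) * x)"
      by (simp add: algebra_simps)
    also have "\<dots> \<le> 2 * b * (h1 x * x powr (1 + \<gamma> / 2) * y + h1 y * y powr (1 + \<gamma> / 2) * x)"
      unfolding sy using nn b by (intro mult_left_mono) auto
    finally show ?thesis .
  qed
  then have "d * (2 * (b * h1 x * (x * y))) \<le> 4 * b * (h1 x * x powr (1 + \<gamma> / 2) * y + h1 y * y powr (1 + \<gamma> / 2) * x)"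
    by linarith
  with 1 show ?thesis
    unfolding x_def y_def Q_def d_def by linarith
qed

text \<open>If y <= R and x >= 4 R, then |v - w| >= |v| / 2 and x - y >= 3 x / 4; the constants 3
  and 8 record these two losses. Elsewhere \<open>gain\<close> is 0 and the right-hand side is
  nonnegative by monotonicity of h1.\<close>

lemma gain_le:
  fixes v w :: "real^3"
  assumes \<gamma>: "0 < \<gamma>" "\<gamma> \<le> 1" and R: "0 < R"
    and h1: "\<And>r s. 0 \<le> r \<Longrightarrow> r \<le> s \<Longrightarrow> h1 r \<le> h1 s"
    and y: "w \<bullet> w \<le> R"
  shows "3 * gain \<gamma> h1 R (v \<bullet> v) \<le>
    8 * (norm (v - w) powr \<gamma> * ((h1 (v \<bullet> v) - h1 (w \<bullet> w)) * (v \<bullet> v - w \<bullet> w)))"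
proof -
  define x where "x = v \<bullet> v"
  define y where "y = w \<bullet> w"
  define d where "d = norm (v - w) powr \<gamma>"
  have pos: "0 \<le> x" "0 \<le> y" "0 \<le> d"
    by (auto simp: x_def y_def d_def)
  have yR: "y \<le> R"
    using assms(5) by (simp add: y_def)
  show ?thesis
  proof (cases "4 * R \<le> x")
    case True
    have d: "x powr (\<gamma> / 2) \<le> 2 * d"
      using norm_diff_powr_ge[OF \<gamma>, of w v] True yR by (simp add: x_def y_def d_def)
    have "h1 y \<le> h1 R" "h1 R \<le> h1 x"
      using h1 pos yR True R by auto
    then have "(3 / 4 * x) * (h1 x - h1 R) \<le> (x - y) * (h1 x - h1 y)"
      using True yR R pos by (intro mult_mono) auto
    moreover have "0 \<le> (3 / 4 * x) * (h1 x - h1 R)"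
      using \<open>h1 R \<le> h1 x\<close> pos by auto
    ultimately have "x powr (\<gamma> / 2) * ((3 / 4 * x) * (h1 x - h1 R)) \<le> (2 * d) * ((x - y) * (h1 x - h1 y))"
      using d pos by (intro mult_mono[OF d]) auto
    moreover have "x powr (\<gamma> / 2) * ((3 / 4 * x) * (h1 x - h1 R)) = 3 / 4 * (x powr (1 + \<gamma> / 2) * (h1 x - h1 R))"
      unfolding powr_mult_base[OF pos(1), symmetric] by (simp add: field_simps)
    ultimately show ?thesis
      using True by (simp add: gain_def x_def y_def d_def mult_ac)
  next
    case False
    have "0 \<le> (h1 x - h1 y) * (x - y)"
      using h1[of x y] h1[of y x] pos by (cases "x \<le> y") (auto intro: mult_nonpos_nonpos mult_nonneg_nonneg)
    then show ?thesis
      using False pos by (simp add: gain_def x_def y_def d_def)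
  qed
qed

text \<open>Adding the two orders of v and w turns the first-order parts into -2 |v - w|^\<gamma>
  (h1 x - h1 y) (x - y). The two \<open>gain\<close> terms are never both nonzero, because one needs
  x >= 4 R and the other x <= R, so this single dissipation covers both.\<close>

lemma landau_L_symmetrized_le:
  fixes v w :: "real^3"
  assumes \<gamma>: "0 < \<gamma>" "\<gamma> \<le> 1" and R: "0 < R"
    and h: "C2_radial h h1 h2"
    and h1: "\<And>r. 0 \<le> r \<Longrightarrow> 0 \<le> h1 r" "\<And>r s. 0 \<le> r \<Longrightarrow> r \<le> s \<Longrightarrow> h1 r \<le> h1 s"
    and h2: "\<And>r. 0 \<le> r \<Longrightarrow> 0 \<le> h2 r" "\<And>r. 0 \<le> r \<Longrightarrow> h2 r \<le> b * h1 r"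
    and b: "0 \<le> b"
  shows "landau_L \<gamma> (radial h) v w + landau_L \<gamma> (radial h) w v \<le>
    8 * b * (h1 (v \<bullet> v) * (v \<bullet> v) powr (1 + \<gamma> / 2) * (w \<bullet> w)
      + h1 (w \<bullet> w) * (w \<bullet> w) powr (1 + \<gamma> / 2) * (v \<bullet> v))
    - 3 / 4 * (gain \<gamma> h1 R (v \<bullet> v) * indicator {w. w \<bullet> w \<le> R} w
      + gain \<gamma> h1 R (w \<bullet> w) * indicator {v. v \<bullet> v \<le> R} v)"
proof -
  define x where "x = v \<bullet> v"
  define y where "y = w \<bullet> w"
  define Q where "Q = x * y - (v \<bullet> w)\<^sup>2"
  define d where "d = norm (v - w) powr \<gamma>"
  define P where "P = d * ((h1 x - h1 y) * (x - y))"
  have pos: "0 \<le> x" "0 \<le> y" "0 \<le> d"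
    by (auto simp: x_def y_def d_def)
  have "0 \<le> (h1 x - h1 y) * (x - y)"
    using h1(2)[of x y] h1(2)[of y x] pos
    by (cases "x \<le> y") (auto intro: mult_nonpos_nonpos mult_nonneg_nonneg)
  then have P: "0 \<le> P"
    using pos by (simp add: P_def)
  have "3 / 4 * (gain \<gamma> h1 R x * indicator {w. w \<bullet> w \<le> R} w
      + gain \<gamma> h1 R y * indicator {v. v \<bullet> v \<le> R} v) \<le> 2 * P"
  proof (cases "x \<le> R")
    case xR: True
    then have "gain \<gamma> h1 R x = 0"
      using R by (simp add: gain_def)
    moreover have "3 * gain \<gamma> h1 R y \<le> 8 * P"
      using gain_le[where ?h1.0 = h1, OF \<gamma> R h1(2), of v w] xR
      by (simp add: x_def y_def P_def d_def norm_minus_commute algebra_simps)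
    ultimately show ?thesis
      using xR by (simp add: x_def)
  next
    case xR: False
    have "3 * gain \<gamma> h1 R x \<le> 8 * P" if "y \<le> R"
      using gain_le[where ?h1.0 = h1, OF \<gamma> R h1(2), of w v] that
      by (simp add: x_def y_def P_def d_def)
    then show ?thesis
      using xR P by (auto simp: x_def y_def indicator_def)
  qed
  moreover have "d * (2 * h2 x * Q) \<le> 4 * b * (h1 x * x powr (1 + \<gamma> / 2) * y + h1 y * y powr (1 + \<gamma> / 2) * x)"
    using cross_term_le[where ?h1.0 = h1 and ?h2.0 = h2 and b = b, OF \<gamma> h1 h2 b, of v w] by (simp add: x_def y_def d_def Q_def)
  moreover have "d * (2 * h2 y * Q) \<le> 4 * b * (h1 x * x powr (1 + \<gamma> / 2) * y + h1 y * y powr (1 + \<gamma> / 2) * x)"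
    using cross_term_le[where ?h1.0 = h1 and ?h2.0 = h2 and b = b, OF \<gamma> h1 h2 b, of w v]
    by (simp add: x_def y_def d_def Q_def norm_minus_commute inner_commute mult_ac add_ac)
  moreover have "landau_L \<gamma> (radial h) v w + landau_L \<gamma> (radial h) w v
      = - 2 * P + d * (2 * h2 x * Q) + d * (2 * h2 y * Q)"
    unfolding landau_L_radial[OF h]
    by (simp add: x_def y_def d_def Q_def P_def norm_minus_commute inner_commute algebra_simps)
  ultimately show ?thesis
    unfolding x_def[symmetric] y_def[symmetric] by linarith
qed

section \<open>Test functions of linear growth, integrated against one measure\<close>

definition tame :: "real \<Rightarrow> (real \<Rightarrow> real) \<Rightarrow> (real \<Rightarrow> real) \<Rightarrow> (real \<Rightarrow> real) \<Rightarrow> bool" where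
  "tame C h h1 h2 \<longleftrightarrow> C2_radial h h1 h2 \<and>
     (\<forall>r\<ge>0. \<bar>h r\<bar> \<le> C * (1 + r) \<and> \<bar>h1 r\<bar> \<le> C \<and> (1 + r) * \<bar>h2 r\<bar> \<le> C)"

lemma C2_radial_continuous:
  assumes "C2_radial h h1 h2"
  shows "continuous_on UNIV (\<lambda>v::real^3. h (v \<bullet> v))"
    "continuous_on UNIV (\<lambda>v::real^3. h1 (v \<bullet> v))"
    "continuous_on UNIV (\<lambda>v::real^3. h2 (v \<bullet> v))"
proof -
  have "continuous_on {-1<..} h" "continuous_on {-1<..} h1" "continuous_on {-1<..} h2"
    using assms by (auto simp: C2_radial_def intro!: continuous_at_imp_continuous_on DERIV_isCont)
  moreover have "continuous_on UNIV (\<lambda>v::real^3. g (v \<bullet> v))" if "continuous_on {-1<..} g" for g :: "real \<Rightarrow> real"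
    using inner_self_gt_minus_one
    by (intro continuous_on_compose2[OF that]) (auto intro!: continuous_intros)
  ultimately show "continuous_on UNIV (\<lambda>v::real^3. h (v \<bullet> v))"
    "continuous_on UNIV (\<lambda>v::real^3. h1 (v \<bullet> v))"
    "continuous_on UNIV (\<lambda>v::real^3. h2 (v \<bullet> v))"
    by blast+
qed

lemma C2_radial_measurable:
  assumes "C2_radial h h1 h2"
  shows "(\<lambda>v::real^3. h (v \<bullet> v)) \<in> borel_measurable borel"
    "(\<lambda>v::real^3. h1 (v \<bullet> v)) \<in> borel_measurable borel"
    "(\<lambda>v::real^3. h2 (v \<bullet> v)) \<in> borel_measurable borel"
  using C2_radial_continuous[OF assms] by (auto intro: borel_measurable_continuous_onI)

lemma weight_measurable [measurable]: "weight \<gamma> \<in> borel_measurable borel"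
  unfolding weight_def by measurable

lemma landau_L_radial_measurable:
  assumes h: "C2_radial h h1 h2"
  shows "(\<lambda>(v, w). landau_L \<gamma> (radial h) v w) \<in> borel_measurable (borel \<Otimes>\<^sub>M borel)"
proof -
  note [measurable] = C2_radial_measurable[OF h]
  show ?thesis
    unfolding landau_L_radial[OF h] by measurable
qed

text \<open>This is what almost every time slice of a solution satisfies; estimates at a fixed time
  are proved here without reference to the evolution.\<close>

locale weighted_prob = prob_space \<mu> for \<mu> :: "(real^3) measure" +
  fixes \<gamma> :: real
  assumes sets_eq [measurable_cong]: "sets \<mu> = sets borel"
    and integrable_weight: "integrable \<mu> (weight \<gamma>)"
    and \<gamma>: "0 < \<gamma>" "\<gamma> \<le> 1"
begin

sublocale pair: pair_prob_space \<mu> \<mu> ..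

lemma product_integral:
  fixes F G :: "real^3 \<Rightarrow> real"
  assumes F: "integrable \<mu> F" and G: "integrable \<mu> G"
  shows "integrable (\<mu> \<Otimes>\<^sub>M \<mu>) (\<lambda>(v, w). F v * G w)"
    "(\<integral>(v, w). F v * G w \<partial>(\<mu> \<Otimes>\<^sub>M \<mu>)) = (\<integral>v. F v \<partial>\<mu>) * (\<integral>w. G w \<partial>\<mu>)"
proof -
  have [measurable]: "F \<in> borel_measurable \<mu>" "G \<in> borel_measurable \<mu>"
    using F G by auto
  show i: "integrable (\<mu> \<Otimes>\<^sub>M \<mu>) (\<lambda>(v, w). F v * G w)"
  proof (rule pair.Fubini_integrable)
    show "integrable \<mu> (\<lambda>x. \<integral>y. norm (case (x, y) of (v, w) \<Rightarrow> F v * G w) \<partial>\<mu>)"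
      using F G by (simp add: abs_mult)
    show "AE x in \<mu>. integrable \<mu> (\<lambda>y. case (x, y) of (v, w) \<Rightarrow> F v * G w)"
      using G by simp
  qed measurable
  show "(\<integral>(v, w). F v * G w \<partial>(\<mu> \<Otimes>\<^sub>M \<mu>)) = (\<integral>v. F v \<partial>\<mu>) * (\<integral>w. G w \<partial>\<mu>)"
    using pair.integral_fst'[OF i] by simp
qed

lemma integrable_weight_sum:
  "integrable (\<mu> \<Otimes>\<^sub>M \<mu>) (\<lambda>(v, w). K * (weight \<gamma> v + weight \<gamma> w))"
proof -
  have "integrable \<mu> (\<lambda>_. 1 :: real)"
    by simp
  from product_integral(1)[OF integrable_weight this] product_integral(1)[OF this integrable_weight]
  have "integrable (\<mu> \<Otimes>\<^sub>M \<mu>) (\<lambda>z. K * ((case z of (v, w) \<Rightarrow> weight \<gamma> v) + (case z of (v, w) \<Rightarrow> weight \<gamma> w)))"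
    by (intro integrable_mult_right Bochner_Integration.integrable_add) simp_all
  then show ?thesis
    by (simp only: case_prod_unfold)
qed

lemma integral_weight_sum:
  "(\<integral>(v, w). K * (weight \<gamma> v + weight \<gamma> w) \<partial>(\<mu> \<Otimes>\<^sub>M \<mu>)) = 2 * K * (\<integral>v. weight \<gamma> v \<partial>\<mu>)"
  using pair.integral_fst'[OF integrable_weight_sum[of K]] integrable_weight
  by (simp add: prob_space)

text \<open>\<open>tame\<close> allows linear growth of h but asks for decay of h2, which is what
  bounds the generator by \<open>weight\<close> in v plus \<open>weight\<close> in w. The double
  integral then converges absolutely, and Fubini identifies it with the iterated one.\<close>

lemma
  assumes "tame C h h1 h2"
  shows tame_integrable: "integrable \<mu> (radial h)"
    and tame_landau_L_integrable: "integrable (\<mu> \<Otimes>\<^sub>M \<mu>) (\<lambda>(v, w). landau_L \<gamma> (radial h) v w)"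
    and tame_landau_weak_rhs:
      "landau_weak_rhs \<gamma> (radial h) \<mu> = (\<integral>(v, w). landau_L \<gamma> (radial h) v w \<partial>(\<mu> \<Otimes>\<^sub>M \<mu>))"
    and tame_abs_landau_weak_rhs_le:
      "\<bar>landau_weak_rhs \<gamma> (radial h) \<mu>\<bar> \<le> 16 * C * (\<integral>v. weight \<gamma> v \<partial>\<mu>)"
proof -
  have h: "C2_radial h h1 h2"
    and b: "0 \<le> r \<Longrightarrow> \<bar>h r\<bar> \<le> C * (1 + r)" "0 \<le> r \<Longrightarrow> \<bar>h1 r\<bar> \<le> C" "0 \<le> r \<Longrightarrow> (1 + r) * \<bar>h2 r\<bar> \<le> C" for r
    using assms by (auto simp: tame_def)
  note [measurable] = C2_radial_measurable[OF h] landau_L_radial_measurable[OF h]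
  have C: "0 \<le> C"
    using b(2)[of 0] by simp
  have "\<bar>h (v \<bullet> v)\<bar> \<le> C * weight \<gamma> v" for v
    using b(1)[of "v \<bullet> v"] mult_left_mono[OF inner_self_le_weight[OF \<gamma>(1), of v] C] by simp
  then show "integrable \<mu> (radial h)"
    using weight_nonneg C
    by (intro Bochner_Integration.integrable_bound[OF integrable_mult_right[OF integrable_weight, of C]])
       (auto simp: abs_mult)
  have bL: "\<bar>landau_L \<gamma> (radial h) v w\<bar> \<le> 8 * C * (weight \<gamma> v + weight \<gamma> w)" for v w
    using \<gamma> h b by (intro abs_landau_L_radial_le)
  show i: "integrable (\<mu> \<Otimes>\<^sub>M \<mu>) (\<lambda>(v, w). landau_L \<gamma> (radial h) v w)"
  proof (rule Bochner_Integration.integrable_bound[OF integrable_weight_sum[of "8 * C"]])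
    show "AE z in \<mu> \<Otimes>\<^sub>M \<mu>. norm (case z of (v, w) \<Rightarrow> landau_L \<gamma> (radial h) v w)
        \<le> norm (case z of (v, w) \<Rightarrow> 8 * C * (weight \<gamma> v + weight \<gamma> w))"
      by (intro AE_I2) (use order_trans[OF bL abs_ge_self] in auto)
  qed measurable
  show eq: "landau_weak_rhs \<gamma> (radial h) \<mu> = (\<integral>(v, w). landau_L \<gamma> (radial h) v w \<partial>(\<mu> \<Otimes>\<^sub>M \<mu>))"
    using pair.integral_fst'[OF i] by (simp add: landau_weak_rhs_def)
  have "norm (\<integral>(v, w). landau_L \<gamma> (radial h) v w \<partial>(\<mu> \<Otimes>\<^sub>M \<mu>))
      \<le> (\<integral>(v, w). 8 * C * (weight \<gamma> v + weight \<gamma> w) \<partial>(\<mu> \<Otimes>\<^sub>M \<mu>))"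
    by (rule Bochner_Integration.integral_norm_bound_integral[OF i integrable_weight_sum]) (use bL in auto)
  then show "\<bar>landau_weak_rhs \<gamma> (radial h) \<mu>\<bar> \<le> 16 * C * (\<integral>v. weight \<gamma> v \<partial>\<mu>)"
    unfolding eq integral_weight_sum by simp
qed

text \<open>On radial functions the generator sees only h1 and h2, so convergence of h itself does
  not enter; the common constant C supplies one dominating function.\<close>

lemma landau_weak_rhs_tendsto:
  assumes hn: "\<And>n. tame C (h n) (h1 n) (h2 n)" and h: "tame C g g1 g2"
    and lim: "\<And>r. 0 \<le> r \<Longrightarrow> (\<lambda>n. h1 n r) \<longlonglongrightarrow> g1 r" "\<And>r. 0 \<le> r \<Longrightarrow> (\<lambda>n. h2 n r) \<longlonglongrightarrow> g2 r"
  shows "(\<lambda>n. landau_weak_rhs \<gamma> (radial (h n)) \<mu>) \<longlonglongrightarrow> landau_weak_rhs \<gamma> (radial g) \<mu>"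
  unfolding tame_landau_weak_rhs[OF hn] tame_landau_weak_rhs[OF h]
proof (rule integral_dominated_convergence)
  have hn': "C2_radial (h n) (h1 n) (h2 n)" for n
    using hn by (simp add: tame_def)
  have g': "C2_radial g g1 g2"
    using h by (simp add: tame_def)
  note [measurable] = landau_L_radial_measurable[OF hn'] landau_L_radial_measurable[OF g']
  show "(\<lambda>(v, w). landau_L \<gamma> (radial g) v w) \<in> borel_measurable (\<mu> \<Otimes>\<^sub>M \<mu>)"
    "\<And>n. (\<lambda>(v, w). landau_L \<gamma> (radial (h n)) v w) \<in> borel_measurable (\<mu> \<Otimes>\<^sub>M \<mu>)"
    by measurable
  show "integrable (\<mu> \<Otimes>\<^sub>M \<mu>) (\<lambda>(v, w). 8 * C * (weight \<gamma> v + weight \<gamma> w))"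
    by (rule integrable_weight_sum)
  show "AE z in \<mu> \<Otimes>\<^sub>M \<mu>. norm (case z of (v, w) \<Rightarrow> landau_L \<gamma> (radial (h n)) v w)
        \<le> (case z of (v, w) \<Rightarrow> 8 * C * (weight \<gamma> v + weight \<gamma> w))" for n
  proof (intro AE_I2, clarify)
    fix v w
    show "norm (landau_L \<gamma> (radial (h n)) v w) \<le> 8 * C * (weight \<gamma> v + weight \<gamma> w)"
      unfolding real_norm_def using hn[of n]
      by (intro abs_landau_L_radial_le[OF \<gamma> hn']) (auto simp: tame_def)
  qed
  show "AE z in \<mu> \<Otimes>\<^sub>M \<mu>. (\<lambda>n. case z of (v, w) \<Rightarrow> landau_L \<gamma> (radial (h n)) v w)
      \<longlonglongrightarrow> (case z of (v, w) \<Rightarrow> landau_L \<gamma> (radial g) v w)"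
    unfolding landau_L_radial[OF hn'] landau_L_radial[OF g']
    by (intro AE_I2) (auto intro!: tendsto_intros lim)
qed

end

lemma radial_integral_tendsto:
  assumes \<mu>: "sets \<mu> = sets borel" "integrable \<mu> (\<lambda>v. 1 + v \<bullet> v)"
    and hn: "\<And>n. tame C (h n) (h1 n) (h2 n)" and h: "tame C g g1 g2"
    and lim: "\<And>r. 0 \<le> r \<Longrightarrow> (\<lambda>n. h n r) \<longlonglongrightarrow> g r"
  shows "(\<lambda>n. \<integral>v. radial (h n) v \<partial>\<mu>) \<longlonglongrightarrow> (\<integral>v. radial g v \<partial>(\<mu> :: (real^3) measure))"
proof (rule integral_dominated_convergence)
  have m: "borel_measurable \<mu> = (borel_measurable borel :: (real^3 \<Rightarrow> real) set)"
    using \<mu> by (intro measurable_cong_sets) auto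
  show "radial g \<in> borel_measurable \<mu>"
    unfolding m using h C2_radial_measurable(1) by (auto simp: tame_def)
  show "radial (h n) \<in> borel_measurable \<mu>" for n
    unfolding m using hn[of n] C2_radial_measurable(1) by (auto simp: tame_def)
  show "integrable \<mu> (\<lambda>v. C * (1 + v \<bullet> v))"
    using \<mu> by simp
  show "AE v in \<mu>. norm (radial (h n) v) \<le> C * (1 + v \<bullet> v)" for n
    using hn[of n] by (simp add: tame_def)
  show "AE v in \<mu>. (\<lambda>n. radial (h n) v) \<longlonglongrightarrow> radial g v"
    by (simp add: lim)
qed

section \<open>Truncation of linear growth by a rational cutoff\<close>

definition cutoff :: "real \<Rightarrow> real \<Rightarrow> real" where
  "cutoff n r = n / (n + r)"

definition cutoff1 :: "real \<Rightarrow> real \<Rightarrow> real" where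
  "cutoff1 n r = - n / (n + r) ^ 2"

definition cutoff2 :: "real \<Rightarrow> real \<Rightarrow> real" where
  "cutoff2 n r = 2 * n / (n + r) ^ 3"

lemma cutoff_DERIV:
  assumes "1 \<le> n" "-1 < r"
  shows "(cutoff n has_real_derivative cutoff1 n r) (at r)"
    "(cutoff1 n has_real_derivative cutoff2 n r) (at r)"
proof -
  have "n + r \<noteq> 0"
    using assms by simp
  then show "(cutoff n has_real_derivative cutoff1 n r) (at r)"
    unfolding cutoff_def cutoff1_def
    by (auto intro!: derivative_eq_intros simp: power2_eq_square)
  show "(cutoff1 n has_real_derivative cutoff2 n r) (at r)"
    unfolding cutoff1_def cutoff2_def using \<open>n + r \<noteq> 0\<close>
    by (auto intro!: derivative_eq_intros simp: divide_simps eval_nat_numeral)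
qed

lemma cutoff_tendsto:
  "(\<lambda>n. cutoff (real (Suc n)) r) \<longlonglongrightarrow> 1"
  "(\<lambda>n. cutoff1 (real (Suc n)) r) \<longlonglongrightarrow> 0"
  "(\<lambda>n. cutoff2 (real (Suc n)) r) \<longlonglongrightarrow> 0"
  unfolding cutoff_def cutoff1_def cutoff2_def by real_asymp+

text \<open>Two kinds of bounds: those free of n keep the truncations uniformly tame, those with n
  on the right make each single truncation bounded.\<close>

lemma cutoff_bounds:
  assumes n: "1 \<le> n" and r: "0 \<le> r"
  shows "0 \<le> cutoff n r" "cutoff n r \<le> 1" "(1 + r) * cutoff n r \<le> n"
    "(1 + r) * \<bar>cutoff1 n r\<bar> \<le> 1" "(1 + r) * ((1 + r) * \<bar>cutoff1 n r\<bar>) \<le> n"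
    "(1 + r) * ((1 + r) * \<bar>cutoff2 n r\<bar>) \<le> 2"
proof -
  have p: "0 < n + r"
    using assms by simp
  show c: "0 \<le> cutoff n r" "cutoff n r \<le> 1"
    using assms by (auto simp: cutoff_def)
  have q: "(1 + r) / (n + r) \<le> 1" "0 \<le> (1 + r) / (n + r)"
    using assms p by auto
  have "(1 + r) * cutoff n r = ((1 + r) / (n + r)) * n"
    by (simp add: cutoff_def)
  also have "\<dots> \<le> 1 * n"
    using q n by (intro mult_right_mono) auto
  finally show e: "(1 + r) * cutoff n r \<le> n"
    by simp
  have c1: "(1 + r) * \<bar>cutoff1 n r\<bar> = ((1 + r) / (n + r)) * cutoff n r"
    using n p by (simp add: cutoff_def cutoff1_def power2_eq_square abs_mult)
  then show "(1 + r) * \<bar>cutoff1 n r\<bar> \<le> 1"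
    using mult_mono[OF q(1) c(2)] c q by simp
  have "((1 + r) / (n + r)) * ((1 + r) * cutoff n r) \<le> 1 * n"
    using q e n r c by (intro mult_mono) auto
  then show "(1 + r) * ((1 + r) * \<bar>cutoff1 n r\<bar>) \<le> n"
    by (simp add: c1 mult_ac)
  have c2: "(1 + r) * ((1 + r) * \<bar>cutoff2 n r\<bar>) = 2 * (((1 + r) / (n + r)) * (((1 + r) / (n + r)) * cutoff n r))"
    using n p by (simp add: cutoff_def cutoff2_def power3_eq_cube abs_mult mult_ac)
  have "((1 + r) / (n + r)) * (((1 + r) / (n + r)) * cutoff n r) \<le> 1 * (1 * 1)"
    using q c r p by (intro mult_mono) auto
  then show "(1 + r) * ((1 + r) * \<bar>cutoff2 n r\<bar>) \<le> 2"
    unfolding c2 by linarith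
qed

text \<open>The tameness constant is independent of n, as dominated convergence requires; 5 = 1 + 2
  + 2 adds up the three terms of the product rule for k2. The bounds for \<open>C2b\<close> may and
  do depend on n.\<close>

lemma tame_truncation:
  assumes h: "tame C h h1 h2" and n: "1 \<le> n"
  defines "k \<equiv> \<lambda>r. h r * cutoff n r"
    and "k1 \<equiv> \<lambda>r. h1 r * cutoff n r + h r * cutoff1 n r"
    and "k2 \<equiv> \<lambda>r. h2 r * cutoff n r + 2 * h1 r * cutoff1 n r + h r * cutoff2 n r"
  shows "tame (5 * C) k k1 k2" "radial k \<in> C2b"
proof -
  have h': "C2_radial h h1 h2"
    and b: "0 \<le> r \<Longrightarrow> \<bar>h r\<bar> \<le> C * (1 + r)" "0 \<le> r \<Longrightarrow> \<bar>h1 r\<bar> \<le> C" "0 \<le> r \<Longrightarrow> (1 + r) * \<bar>h2 r\<bar> \<le> C" for r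
    using h by (auto simp: tame_def)
  have C: "0 \<le> C"
    using b(2)[of 0] by simp
  have "continuous_on {-1<..} h" "continuous_on {-1<..} h1" "continuous_on {-1<..} h2"
    using h' by (auto simp: C2_radial_def intro!: continuous_at_imp_continuous_on DERIV_isCont)
  moreover have "continuous_on {-1<..} (cutoff n)" "continuous_on {-1<..} (cutoff1 n)"
    using cutoff_DERIV[OF n] by (auto intro!: continuous_at_imp_continuous_on DERIV_isCont)
  moreover have "continuous_on {-1<..} (cutoff2 n)"
    unfolding cutoff2_def using n by (auto intro!: continuous_intros)
  ultimately have "continuous_on {-1<..} k2"
    unfolding k2_def by (intro continuous_intros)
  then have k: "C2_radial k k1 k2"
    using h' cutoff_DERIV[OF n] unfolding C2_radial_def k_def k1_def k2_def
    by (auto intro!: derivative_eq_intros)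
  have b2: "(1 + r) * \<bar>k2 r\<bar> \<le> 5 * C" if r: "0 \<le> r" for r
  proof -
    note cb = cutoff_bounds[OF n r]
    have "(1 + r) * \<bar>h2 r * cutoff n r\<bar> \<le> C * 1"
      using mult_mono[OF b(3)[OF r] cb(2)] cb(1) C by (simp add: abs_mult mult_ac)
    moreover have "(1 + r) * \<bar>2 * h1 r * cutoff1 n r\<bar> \<le> 2 * (C * 1)"
      using mult_mono[OF b(2)[OF r] cb(4)] C r by (simp add: abs_mult mult_ac)
    moreover have "(1 + r) * \<bar>h r * cutoff2 n r\<bar> \<le> C * 2"
    proof -
      have "(1 + r) * \<bar>h r * cutoff2 n r\<bar> \<le> (1 + r) * ((C * (1 + r)) * \<bar>cutoff2 n r\<bar>)"
        unfolding abs_mult using b(1)[OF r] r by (intro mult_left_mono mult_right_mono) auto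
      also have "\<dots> = C * ((1 + r) * ((1 + r) * \<bar>cutoff2 n r\<bar>))"
        by simp
      also have "\<dots> \<le> C * 2"
        using cb C by (intro mult_left_mono) auto
      finally show ?thesis .
    qed
    moreover have "(1 + r) * \<bar>k2 r\<bar> \<le> (1 + r) * (\<bar>h2 r * cutoff n r\<bar> + \<bar>2 * h1 r * cutoff1 n r\<bar> + \<bar>h r * cutoff2 n r\<bar>)"
      unfolding k2_def using r by (intro mult_left_mono) linarith+
    ultimately show ?thesis
      by (simp add: distrib_left)
  qed
  have hc1: "\<bar>h r * cutoff1 n r\<bar> \<le> C * ((1 + r) * \<bar>cutoff1 n r\<bar>)" if r: "0 \<le> r" for r
    using mult_right_mono[OF b(1)[OF r], of "\<bar>cutoff1 n r\<bar>"] by (simp add: abs_mult mult_ac)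
  have b1: "\<bar>k1 r\<bar> \<le> 2 * C" if r: "0 \<le> r" for r
  proof -
    note cb = cutoff_bounds[OF n r]
    have "\<bar>h1 r * cutoff n r\<bar> \<le> C * 1"
      unfolding abs_mult using b(2)[OF r] cb C by (intro mult_mono) auto
    moreover have "C * ((1 + r) * \<bar>cutoff1 n r\<bar>) \<le> C * 1"
      using cb C by (intro mult_left_mono) auto
    ultimately show ?thesis
      using hc1[OF r] unfolding k1_def by linarith
  qed
  have b0: "\<bar>k r\<bar> \<le> C * ((1 + r) * cutoff n r)" if r: "0 \<le> r" for r
    using mult_right_mono[OF b(1)[OF r] cutoff_bounds(1)[OF n r]] cutoff_bounds(1)[OF n r]
    by (simp add: abs_mult mult_ac k_def)
  have "\<bar>k r\<bar> \<le> 5 * C * (1 + r)" if r: "0 \<le> r" for r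
  proof -
    have "(1 + r) * cutoff n r \<le> (1 + r) * 1"
      using cutoff_bounds[OF n r] r by (intro mult_left_mono) auto
    then have "C * ((1 + r) * cutoff n r) \<le> C * (1 + r)"
      using C by (intro mult_left_mono) auto
    moreover have "C * (1 + r) \<le> 5 * C * (1 + r)"
      using C r by (intro mult_right_mono) auto
    ultimately show ?thesis
      using b0[OF r] by linarith
  qed
  then show "tame (5 * C) k k1 k2"
    using k b1 b2 C by (fastforce simp: tame_def)
  show "radial k \<in> C2b"
  proof (rule radial_in_C2b[OF k])
    fix r :: real assume r: "0 \<le> r"
    note cb = cutoff_bounds[OF n r]
    have Cn: "C \<le> C * n" "0 \<le> C * n"
      using mult_left_mono[OF n C] C n by auto
    have 1: "C * ((1 + r) * cutoff n r) \<le> C * n"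
      using cb C by (intro mult_left_mono) auto
    then show "\<bar>k r\<bar> \<le> 5 * (C * n)"
      using b0[OF r] Cn by linarith
    show "(1 + r) * \<bar>k2 r\<bar> \<le> 5 * (C * n)"
      using b2[OF r] Cn by linarith
    have "(1 + r) * \<bar>h1 r * cutoff n r\<bar> \<le> C * ((1 + r) * cutoff n r)"
      using mult_right_mono[OF b(2)[OF r], of "(1 + r) * cutoff n r"] cb r by (simp add: abs_mult mult_ac)
    moreover have "(1 + r) * \<bar>h r * cutoff1 n r\<bar> \<le> (1 + r) * (C * ((1 + r) * \<bar>cutoff1 n r\<bar>))"
      using hc1[OF r] r by (intro mult_left_mono) auto
    moreover have "(1 + r) * (C * ((1 + r) * \<bar>cutoff1 n r\<bar>)) \<le> C * n"
      using mult_left_mono[OF cb(5) C] by (simp add: mult_ac)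
    moreover have "(1 + r) * \<bar>k1 r\<bar> \<le> (1 + r) * (\<bar>h1 r * cutoff n r\<bar> + \<bar>h r * cutoff1 n r\<bar>)"
      unfolding k1_def using r by (intro mult_left_mono) auto
    ultimately show "(1 + r) * \<bar>k1 r\<bar> \<le> 5 * (C * n)"
      using 1 Cn by (simp add: distrib_left)
  qed
qed

section \<open>The extended weak formulation\<close>

text \<open>With p = 1 + \<gamma>/2 and e decreasing to 0 this increases to \<open>weight\<close>,
  while each member is an admissible test function.\<close>

definition damped_weight :: "real \<Rightarrow> real \<Rightarrow> real \<Rightarrow> real" where
  "damped_weight p e r = (1 + r) powr p * exp (- (e * r))"

text \<open>The inequality z <= exp z at z = e (1 + r) / 3, raised to the third power.\<close>

lemma cube_exp_le:
  fixes e r :: real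
  assumes "0 < e" "0 \<le> r"
  shows "(1 + r) ^ 3 * exp (- (e * r)) \<le> 27 * exp e / e ^ 3"
proof -
  define z where "z = e * (1 + r) / 3"
  have z: "0 \<le> z"
    using assms by (simp add: z_def)
  have "z ^ 3 \<le> exp z ^ 3"
    using exp_ge_add_one_self[of z] z by (intro power_mono) linarith+
  also have "\<dots> = exp (e * (1 + r))"
    by (simp add: z_def flip: exp_of_nat_mult)
  finally have "e ^ 3 * (1 + r) ^ 3 \<le> 27 * exp (e * (1 + r))"
    by (simp add: z_def power_divide power_mult_distrib)
  then have "e ^ 3 * (1 + r) ^ 3 * exp (- (e * r)) \<le> 27 * exp (e * (1 + r)) * exp (- (e * r))"
    by (intro mult_right_mono) auto
  also have "\<dots> = 27 * exp e"
    by (simp add: algebra_simps flip: exp_add)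
  finally show ?thesis
    using assms by (simp add: field_simps)
qed

lemma damped_weight_in_C2b:
  assumes p: "1 \<le> p" "p \<le> 2" and e: "0 < e" "e \<le> 1"
  shows "radial (damped_weight p e) \<in> C2b"
proof -
  define E where "E r = exp (- (e * r))" for r
  define h1 where "h1 r = (p * (1 + r) powr (p - 1) - e * (1 + r) powr p) * E r" for r
  define h2 where "h2 r = (p * ((p - 1) * (1 + r) powr (p - 2)) - 2 * p * e * (1 + r) powr (p - 1)
    + e * e * (1 + r) powr p) * E r" for r
  define K where "K = 27 * exp e / e ^ 3"
  have dE: "(E has_real_derivative - e * E r) (at r)" for r
    unfolding E_def by (auto intro!: derivative_eq_intros)
  have dp: "((\<lambda>r. (1 + r) powr q) has_real_derivative q * (1 + r) powr (q - 1)) (at r)"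
    if "-1 < r" for q r :: real
    using DERIV_fun_powr[of "\<lambda>r. 1 + r" 1 r q] that by (auto intro!: derivative_eq_intros)
  have "C2_radial (damped_weight p e) h1 h2"
    unfolding C2_radial_def
  proof (intro conjI allI impI)
    fix r :: real assume r: "-1 < r"
    have "((\<lambda>r. (1 + r) powr p * E r) has_real_derivative h1 r) (at r)"
      by (rule derivative_eq_intros dE dp r refl)+ (simp add: h1_def algebra_simps)
    then show "(damped_weight p e has_real_derivative h1 r) (at r)"
      by (simp add: damped_weight_def[abs_def] E_def)
    show "(h1 has_real_derivative h2 r) (at r)"
      unfolding h1_def[abs_def]
      by (rule derivative_eq_intros dE dp r refl)+ (simp add: h2_def algebra_simps)
  next
    show "continuous_on {- 1<..} h2"
      unfolding h2_def[abs_def] E_def by (intro continuous_intros) auto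
  qed
  then show ?thesis
  proof (rule radial_in_C2b)
    fix r :: real assume r: "0 \<le> r"
    \<comment> \<open>One more factor 1 + r raises an exponent of at most 2 to at most 3, the order
      handled by \<open>cube_exp_le\<close>.\<close>
    have pw: "(1 + r) * ((1 + r) powr q * E r) \<le> K" "(1 + r) powr q * E r \<le> K" if "q \<le> 2" for q
    proof -
      have "(1 + r) powr q \<le> (1 + r) powr 2"
        using that r by (intro powr_mono) auto
      then have "(1 + r) * ((1 + r) powr q * E r) \<le> (1 + r) * ((1 + r) ^ 2 * E r)"
        using r by (intro mult_left_mono mult_right_mono) (auto simp: E_def)
      also have "\<dots> = (1 + r) ^ 3 * E r"
        by (simp add: power3_eq_cube power2_eq_square)
      also have "\<dots> \<le> K"
        unfolding E_def K_def by (rule cube_exp_le[OF e(1) r])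
      finally show "(1 + r) * ((1 + r) powr q * E r) \<le> K" .
      moreover have "1 * ((1 + r) powr q * E r) \<le> (1 + r) * ((1 + r) powr q * E r)"
        using r by (intro mult_right_mono) (auto simp: E_def)
      ultimately show "(1 + r) powr q * E r \<le> K"
        by linarith
    qed
    have E0: "0 \<le> E r" by (simp add: E_def)
    have K: "0 \<le> K" using e by (simp add: K_def)
    show "\<bar>damped_weight p e r\<bar> \<le> 7 * K"
      using pw(2)[OF p(2)] K r unfolding damped_weight_def E_def by (simp add: abs_mult)
    define A where "A q = (1 + r) * ((1 + r) powr q * E r)" for q
    have A: "0 \<le> A q" "q \<le> 2 \<Longrightarrow> A q \<le> K" for q
      using pw(1) r E0 by (auto simp: A_def)
    have A3: "A (p - 2) \<le> K" "A (p - 1) \<le> K" "A p \<le> K"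
      using A p by auto
    have le: "c * a \<le> c' * K" if "0 \<le> c" "c \<le> c'" "0 \<le> a" "a \<le> K" for c c' a
      using that by (intro mult_mono) auto
    have "(1 + r) * h1 r = p * A (p - 1) - e * A p"
      by (simp add: h1_def A_def algebra_simps)
    moreover have "p * A (p - 1) \<le> 2 * K" "e * A p \<le> 1 * K"
      by (rule le; use p e A A3 in simp)+
    ultimately have "\<bar>(1 + r) * h1 r\<bar> \<le> 7 * K"
      using A p e K mult_nonneg_nonneg[of p "A (p - 1)"] mult_nonneg_nonneg[of e "A p"]
      by (smt (verit))
    then show "(1 + r) * \<bar>h1 r\<bar> \<le> 7 * K"
      using r by (simp add: abs_mult)
    have "(1 + r) * h2 r = (p * (p - 1)) * A (p - 2) - (2 * p * e) * A (p - 1) + (e * e) * A p"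
      by (simp add: h2_def A_def algebra_simps)
    \<comment> \<open>The coefficient bounds 2 + 4 + 1 are the origin of the 7 in all three
      estimates.\<close>
    moreover have "p * (p - 1) \<le> 2" "2 * p * e \<le> 4" "e * e \<le> 1"
      using p e mult_mono[of p 2 "p - 1" 1] mult_mono[of p 2 e 1] mult_mono[of e 1 e 1]
      by (simp_all add: mult.commute)
    then have "(p * (p - 1)) * A (p - 2) \<le> 2 * K" "(2 * p * e) * A (p - 1) \<le> 4 * K" "(e * e) * A p \<le> 1 * K"
      by (intro le; use p e A A3 in simp)+
    moreover have "0 \<le> (p * (p - 1)) * A (p - 2)" "0 \<le> (2 * p * e) * A (p - 1)" "0 \<le> (e * e) * A p"
      using p e A by auto
    ultimately have "\<bar>(1 + r) * h2 r\<bar> \<le> 7 * K"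
      by linarith
    then show "(1 + r) * \<bar>h2 r\<bar> \<le> 7 * K"
      using r by (simp add: abs_mult)
  qed
qed

section \<open>Moments of a solution and the weak equation for tame functions\<close>

locale landau_solution =
  fixes \<gamma> :: real and f :: "real \<Rightarrow> (real^3) measure"
  assumes \<gamma>: "0 < \<gamma>" "\<gamma> \<le> 1"
    and solution: "landau_weak_solution \<gamma> f"
begin

lemma prob_space_f: "0 \<le> t \<Longrightarrow> prob_space (f t)"
  and sets_f: "0 \<le> t \<Longrightarrow> sets (f t) = sets borel"
  using solution unfolding landau_weak_solution_def by blast+

lemma measurable_f: "0 \<le> t \<Longrightarrow> borel_measurable (f t) = borel_measurable borel"
  using sets_f by (intro measurable_cong_sets) auto

text \<open>The definition of a solution speaks of positive T; 1 + |T| is positive and dominates T,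
  which spares a case split on the sign.\<close>

lemma moments_finite:
  "(SUP t\<in>{0..1 + \<bar>T\<bar>}. moment 2 (f t))
    + (\<integral>\<^sup>+t\<in>{0..1 + \<bar>T\<bar>}. moment (2 + \<gamma>) (f t) \<partial>lborel) < \<infinity>"
  using solution unfolding landau_weak_solution_def by (metis abs_add_one_gt_zero)

lemma moment_finite: "0 \<le> t \<Longrightarrow> moment 2 (f t) < \<infinity>"
proof -
  assume "0 \<le> t"
  then have "moment 2 (f t) \<le> (SUP s\<in>{0..1 + \<bar>t\<bar>}. moment 2 (f s))"
    by (intro SUP_upper) auto
  also have "\<dots> < \<infinity>"
    by (rule le_less_trans[OF _ moments_finite[of t]]) (simp add: add_increasing2)
  finally show ?thesis .
qed

lemma moment_le: "0 \<le> t \<Longrightarrow> moment 2 (f t) \<le> moment 2 (f 0)"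
  using solution unfolding landau_weak_solution_def by blast

lemma moment_two: "moment 2 \<mu> = (\<integral>\<^sup>+v. ennreal (v \<bullet> v) \<partial>\<mu>)"
  unfolding moment_def by (intro nn_integral_cong) (simp add: power2_norm_eq_inner)

lemma integrable_energy: "0 \<le> t \<Longrightarrow> integrable (f t) (\<lambda>v. v \<bullet> v)"
  using moment_finite[of t] by (intro integrableI_nonneg) (auto simp: moment_two measurable_f)

lemma integrable_one_energy:
  assumes "0 \<le> t"
  shows "integrable (f t) (\<lambda>v. 1 + v \<bullet> v)"
proof -
  interpret prob_space "f t"
    by (rule prob_space_f[OF assms])
  show ?thesis
    using integrable_energy[OF assms] by (intro Bochner_Integration.integrable_add) simp_all
qed

lemma energy_le:
  assumes "0 \<le> t"
  shows "(\<integral>v. v \<bullet> v \<partial>f t) \<le> enn2real (moment 2 (f 0))"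
proof -
  have "(\<integral>v. v \<bullet> v \<partial>f t) = enn2real (moment 2 (f t))"
    unfolding moment_two using assms by (intro integral_eq_nn_integral) (auto simp: measurable_f)
  also have "\<dots> \<le> enn2real (moment 2 (f 0))"
    using moment_le[OF assms] moment_finite[of 0] by (intro enn2real_mono) simp_all
  finally show ?thesis .
qed

lemma
  assumes "\<phi> \<in> C2b" "0 \<le> t"
  shows weak_set_integrable: "set_integrable lborel {0..t} (\<lambda>s. landau_weak_rhs \<gamma> \<phi> (f s))"
    and weak_equation: "(\<integral>v. \<phi> v \<partial>f t) =
      (\<integral>v. \<phi> v \<partial>f 0) + (LINT s:{0..t}|lborel. landau_weak_rhs \<gamma> \<phi> (f s))"
  using solution assms unfolding landau_weak_solution_def by blast+

text \<open>An indefinite integral is continuous in its endpoint. This provides the measurability in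
  time of the integral of \<open>weight\<close>.\<close>

lemma weak_continuous:
  assumes "\<phi> \<in> C2b"
  shows "continuous_on {0..T} (\<lambda>t. \<integral>v. \<phi> v \<partial>f t)"
proof (cases "0 \<le> T")
  case True
  have "continuous_on {0..T} (\<lambda>t. (\<integral>v. \<phi> v \<partial>f 0) + integral {0..t} (\<lambda>s. landau_weak_rhs \<gamma> \<phi> (f s)))"
    using weak_set_integrable[OF assms True]
    by (intro continuous_intros indefinite_integral_continuous_1 set_borel_integral_eq_integral)
  then show ?thesis
  proof (rule continuous_on_eq)
    fix t assume "t \<in> {0..T}"
    then show "(\<integral>v. \<phi> v \<partial>f 0) + integral {0..t} (\<lambda>s. landau_weak_rhs \<gamma> \<phi> (f s)) = (\<integral>v. \<phi> v \<partial>f t)"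
      using weak_equation[OF assms, of t] weak_set_integrable[OF assms, of t]
      by (simp add: set_borel_integral_eq_integral)
  qed
qed simp

definition total_weight :: "real \<Rightarrow> ennreal" where
  "total_weight s = (\<integral>\<^sup>+v. ennreal (weight \<gamma> v) \<partial>f s)"

text \<open>
  \<open>weight\<close> is the increasing limit of test functions, so its integral is a limit of
  continuous functions of time.
\<close>

lemma total_weight_measurable [measurable]:
  "(\<lambda>s. total_weight s * indicator {0..T} s) \<in> borel_measurable lborel"
proof -
  define \<phi> where "\<phi> n = damped_weight (1 + \<gamma> / 2) (1 / real (Suc n))" for n
  have \<phi>: "radial (\<phi> n) \<in> C2b" for n
    unfolding \<phi>_def using \<gamma> by (intro damped_weight_in_C2b) auto
  have nonneg: "0 \<le> \<phi> n r" for n r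
    by (simp add: \<phi>_def damped_weight_def)
  have mono: "\<phi> n r \<le> \<phi> (Suc n) r" if "0 \<le> r" for n r
  proof -
    have "1 / real (Suc (Suc n)) * r \<le> 1 / real (Suc n) * r"
      using that by (intro mult_right_mono divide_left_mono) auto
    then show ?thesis
      unfolding \<phi>_def damped_weight_def by (intro mult_left_mono) auto
  qed
  have meas: "radial (\<phi> n) \<in> borel_measurable borel" for n
    unfolding \<phi>_def damped_weight_def by measurable
  have lim: "(\<lambda>n. ennreal (indicator {0..T} s *\<^sub>R (\<integral>v. \<phi> n (v \<bullet> v) \<partial>f s)))
      \<longlonglongrightarrow> total_weight s * indicator {0..T} s" for s
  proof (cases "s \<in> {0..T}")
    case True
    then have s: "0 \<le> s" by simp
    interpret prob_space "f s"
      by (rule prob_space_f[OF s])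
    have "integrable (f s) (radial (\<phi> n))" for n
    proof -
      obtain B where "\<And>v. norm (radial (\<phi> n) v) \<le> B"
        using \<phi>[of n] by (auto simp: C2b_def bounded_iff)
      then show ?thesis
        using meas by (intro integrable_const_bound[of _ B]) (auto simp: measurable_f[OF s])
    qed
    then have eq: "ennreal (\<integral>v. \<phi> n (v \<bullet> v) \<partial>f s) = (\<integral>\<^sup>+v. ennreal (\<phi> n (v \<bullet> v)) \<partial>f s)" for n
      by (intro nn_integral_eq_integral[symmetric]) (auto simp: nonneg)
    have "(\<lambda>n. \<integral>\<^sup>+v. ennreal (\<phi> n (v \<bullet> v)) \<partial>f s) \<longlonglongrightarrow> (\<integral>\<^sup>+v. ennreal (weight \<gamma> v) \<partial>f s)"
    proof (rule nn_integral_LIMSEQ)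
      show "incseq (\<lambda>n v. ennreal (\<phi> n (v \<bullet> v)))"
        by (intro incseq_SucI le_funI ennreal_leI mono) simp
      show "(\<lambda>v. ennreal (\<phi> n (v \<bullet> v))) \<in> borel_measurable (f s)" for n
        unfolding measurable_f[OF s] using meas[of n] by measurable
      show "(\<lambda>n. ennreal (\<phi> n (v \<bullet> v))) \<longlonglongrightarrow> ennreal (weight \<gamma> v)" for v
      proof (rule tendsto_ennrealI)
        have "(\<lambda>n. inverse (real (Suc n)) * (v \<bullet> v)) \<longlonglongrightarrow> 0 * (v \<bullet> v)"
          by (intro tendsto_mult LIMSEQ_inverse_real_of_nat tendsto_const)
        then have "(\<lambda>n. exp (- (inverse (real (Suc n)) * (v \<bullet> v)))) \<longlonglongrightarrow> exp (- (0 * (v \<bullet> v)))"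
          by (intro tendsto_exp tendsto_minus)
        then have "(\<lambda>n. exp (- (1 / real (Suc n) * (v \<bullet> v)))) \<longlonglongrightarrow> 1"
          by (simp only: inverse_eq_divide mult_zero_left minus_zero exp_zero)
        from tendsto_mult[OF tendsto_const[of "(1 + v \<bullet> v) powr (1 + \<gamma> / 2)"] this]
        show "(\<lambda>n. \<phi> n (v \<bullet> v)) \<longlonglongrightarrow> weight \<gamma> v"
          by (simp add: \<phi>_def damped_weight_def weight_def)
      qed
    qed
    then show ?thesis
      using True by (simp add: eq total_weight_def)
  qed auto
  have "(\<lambda>s. ennreal (indicator {0..T} s *\<^sub>R (\<integral>v. \<phi> n (v \<bullet> v) \<partial>f s))) \<in> borel_measurable lborel" for n
    using borel_measurable_continuous_on_indicator[OF _ weak_continuous[OF \<phi>[of n]], of T]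
    by (intro measurable_compose[OF _ measurable_ennreal]) simp
  from borel_measurable_LIMSEQ_order[OF lim this] show ?thesis .
qed

text \<open>From 1 + x <= 2 max(1, x); the factor 4 bounds 2^(1 + \<gamma>/2).\<close>

lemma total_weight_le: "total_weight s \<le> 4 * (1 + moment (2 + \<gamma>) (f s))" if "0 \<le> s"
proof -
  interpret prob_space "f s"
    by (rule prob_space_f[OF that])
  have w: "weight \<gamma> v \<le> 4 * (1 + norm v powr (2 + \<gamma>))" for v
  proof -
    define z where "z = max 1 (v \<bullet> v)"
    have "weight \<gamma> v \<le> (2 * z) powr (1 + \<gamma> / 2)"
      unfolding weight_def using \<gamma> by (intro powr_mono2) (auto simp: z_def)
    also have "\<dots> = 2 powr (1 + \<gamma> / 2) * z powr (1 + \<gamma> / 2)"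
      by (simp add: powr_mult z_def)
    also have "\<dots> \<le> 4 * z powr (1 + \<gamma> / 2)"
      using powr_mono[of "1 + \<gamma> / 2" 2 "2::real"] \<gamma> by (intro mult_right_mono) auto
    also have "z powr (1 + \<gamma> / 2) \<le> 1 + (v \<bullet> v) powr (1 + \<gamma> / 2)"
      by (auto simp: z_def max_def)
    also have "(v \<bullet> v) powr (1 + \<gamma> / 2) = norm v powr (2 + \<gamma>)"
      using inner_self_powr_half[of v "2 + \<gamma>"] by (simp add: add_divide_distrib)
    finally show ?thesis by simp
  qed
  have "total_weight s \<le> (\<integral>\<^sup>+v. 4 * (1 + ennreal (norm v powr (2 + \<gamma>))) \<partial>f s)"
    unfolding total_weight_def
  proof (rule nn_integral_mono)
    fix v
    have "ennreal (weight \<gamma> v) \<le> ennreal (4 * (1 + norm v powr (2 + \<gamma>)))"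
      by (rule ennreal_leI[OF w])
    also have "\<dots> = 4 * (1 + ennreal (norm v powr (2 + \<gamma>)))"
      by (subst ennreal_mult, simp, simp, subst ennreal_plus) simp_all
    finally show "ennreal (weight \<gamma> v) \<le> 4 * (1 + ennreal (norm v powr (2 + \<gamma>)))" .
  qed
  also have "\<dots> = 4 * (1 + moment (2 + \<gamma>) (f s))"
    using that
    by (subst nn_integral_cmult, simp add: measurable_f, subst nn_integral_add)
       (simp_all add: measurable_f moment_def emeasure_space_1)
  finally show ?thesis .
qed

lemma total_weight_integral_finite: "(\<integral>\<^sup>+s. total_weight s * indicator {0..T} s \<partial>lborel) < \<infinity>"
proof -
  \<comment> \<open>Time measurability of the moment of order \<open>2 + \<gamma>\<close> is unknown, so only monotonicity of
    its integral may be used.\<close>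
  have le: "(total_weight s * indicator {0..T} s - 4) / 4
      \<le> moment (2 + \<gamma>) (f s) * indicator {0..1 + \<bar>T\<bar>} s" for s
  proof (cases "s \<in> {0..T}")
    case True
    have "total_weight s - 4 \<le> 4 * moment (2 + \<gamma>) (f s)"
      using total_weight_le[of s] True by (intro ennreal_minus_le_iff[THEN iffD2]) (auto simp: distrib_left)
    then have "(total_weight s - 4) / 4 \<le> (4 * moment (2 + \<gamma>) (f s)) / 4"
      by (rule divide_right_mono_ennreal)
    also have "\<dots> = moment (2 + \<gamma>) (f s)"
      by (subst mult.commute) (simp add: ennreal_mult_divide_eq)
    finally show ?thesis
      using True by simp
  qed simp
  have "(\<integral>\<^sup>+s. (total_weight s * indicator {0..T} s - 4) / 4 \<partial>lborel)
      \<le> (\<integral>\<^sup>+t\<in>{0..1 + \<bar>T\<bar>}. moment (2 + \<gamma>) (f t) \<partial>lborel)"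
    by (intro nn_integral_mono le)
  also have "\<dots> < \<infinity>"
    by (rule le_less_trans[OF _ moments_finite[of T]]) (simp add: add_increasing)
  finally have fin: "(\<integral>\<^sup>+s. (total_weight s * indicator {0..T} s - 4) / 4 \<partial>lborel) < \<infinity>" .
  \<comment> \<open>The shift by 4 is undone through a <= 4 + (a - 4), with truncated subtraction.
    All integrands are now measurable, so the integral may be split.\<close>
  have "(\<integral>\<^sup>+s. total_weight s * indicator {0..T} s \<partial>lborel)
      \<le> (\<integral>\<^sup>+s. 4 * indicator {0..T} s + 4 * ((total_weight s * indicator {0..T} s - 4) / 4) \<partial>lborel)"
  proof (rule nn_integral_mono)
    fix s
    have "4 * (a / 4) = a" for a :: ennreal
      by (simp add: ennreal_times_divide mult.commute ennreal_mult_divide_eq)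
    moreover have "a \<le> 4 + (a - 4)" for a :: ennreal
      by (cases "a \<le> 4") (auto simp: ennreal_minus_eq_0 add_diff_inverse_ennreal intro: order_trans)
    ultimately show "total_weight s * indicator {0..T} s
        \<le> 4 * indicator {0..T} s + 4 * ((total_weight s * indicator {0..T} s - 4) / 4)"
      by (cases "s \<in> {0..T}") auto
  qed
  also have "\<dots> = 4 * emeasure lborel {0..T}
      + 4 * (\<integral>\<^sup>+s. (total_weight s * indicator {0..T} s - 4) / 4 \<partial>lborel)"
    by (subst nn_integral_add) (simp_all add: nn_integral_cmult)
  also have "\<dots> < \<infinity>"
    using fin by (auto simp: ennreal_mult_less_top emeasure_lborel_Icc_eq)
  finally show ?thesis .
qed

lemma AE_total_weight_finite: "AE s in lborel. s \<in> {0..T} \<longrightarrow> total_weight s < \<infinity>"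
  using nn_integral_PInf_AE[OF total_weight_measurable[of T]] total_weight_integral_finite[of T]
  by (auto elim!: eventually_mono simp: less_top split: split_indicator)

lemma weighted_prob_f:
  assumes "0 \<le> s" "total_weight s < \<infinity>"
  shows "weighted_prob (f s) \<gamma>"
proof -
  interpret prob_space "f s"
    by (rule prob_space_f[OF assms(1)])
  show ?thesis
  proof
    show "integrable (f s) (weight \<gamma>)"
      using assms by (intro integrableI_nonneg) (auto simp: measurable_f weight_nonneg total_weight_def)
  qed (use assms sets_f \<gamma> in auto)
qed

text \<open>The value 0 is put on the null set of times at which the moment of order 2 + \<gamma>
  may be infinite and the integral of the generator need not converge.\<close>

definition dissipation :: "(real \<Rightarrow> real) \<Rightarrow> real \<Rightarrow> real" where
  "dissipation h s = (if total_weight s < \<infinity> then landau_weak_rhs \<gamma> (radial h) (f s) else 0)"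

text \<open>The equation for the truncations \<open>k n\<close>, which lie in \<open>C2b\<close>,
  passes to the limit: dominated by a multiple of 1 + |v|^2 in the integrals at times 0 and t, and
  by \<open>total_weight\<close> in the time integral.\<close>

lemma
  assumes h: "tame C h h1 h2" and t: "0 \<le> t"
  shows dissipation_integrable: "set_integrable lborel {0..t} (dissipation h)"
    and tame_weak: "(\<integral>v. h (v \<bullet> v) \<partial>f t) = (\<integral>v. h (v \<bullet> v) \<partial>f 0) + (LINT s:{0..t}|lborel. dissipation h s)"
proof -
  define k where "k n r = h r * cutoff (real (Suc n)) r" for n r
  define k1 where "k1 n r = h1 r * cutoff (real (Suc n)) r + h r * cutoff1 (real (Suc n)) r" for n r
  define k2 where "k2 n r = h2 r * cutoff (real (Suc n)) r + 2 * h1 r * cutoff1 (real (Suc n)) r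
    + h r * cutoff2 (real (Suc n)) r" for n r
  have C: "0 \<le> C"
    using h by (auto simp: tame_def dest: spec[of _ 0])
  have k: "tame (5 * C) (k n) (k1 n) (k2 n)" "radial (k n) \<in> C2b" for n
    using tame_truncation[OF h, of "real (Suc n)"] by (auto simp: k_def[abs_def] k1_def[abs_def] k2_def[abs_def])
  have h5: "tame (5 * C) h h1 h2"
    unfolding tame_def
  proof (intro conjI allI impI)
    fix r :: real assume r: "0 \<le> r"
    have "\<bar>h r\<bar> \<le> C * (1 + r)" "\<bar>h1 r\<bar> \<le> C" "(1 + r) * \<bar>h2 r\<bar> \<le> C"
      using h r by (auto simp: tame_def)
    moreover have "C * (1 + r) \<le> 5 * C * (1 + r)"
      using C r by (intro mult_right_mono) auto
    ultimately show "\<bar>h r\<bar> \<le> 5 * C * (1 + r)" "\<bar>h1 r\<bar> \<le> 5 * C" "(1 + r) * \<bar>h2 r\<bar> \<le> 5 * C"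
      using C by linarith+
  qed (use h in \<open>simp add: tame_def\<close>)
  have lim0: "(\<lambda>n. k n r) \<longlonglongrightarrow> h r" for r
    unfolding k_def using tendsto_mult[OF tendsto_const cutoff_tendsto(1)] by fastforce
  have lim1: "(\<lambda>n. k1 n r) \<longlonglongrightarrow> h1 r" for r
  proof -
    have "(\<lambda>n. k1 n r) \<longlonglongrightarrow> h1 r * 1 + h r * 0"
      unfolding k1_def by (intro tendsto_intros cutoff_tendsto)
    then show ?thesis by simp
  qed
  have lim2: "(\<lambda>n. k2 n r) \<longlonglongrightarrow> h2 r" for r
  proof -
    have "(\<lambda>n. k2 n r) \<longlonglongrightarrow> h2 r * 1 + 2 * h1 r * 0 + h r * 0"
      unfolding k2_def by (intro tendsto_intros cutoff_tendsto)
    then show ?thesis by simp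
  qed
  have int_lim: "(\<lambda>n. \<integral>v. k n (v \<bullet> v) \<partial>f s) \<longlonglongrightarrow> (\<integral>v. h (v \<bullet> v) \<partial>f s)" if "0 \<le> s" for s
    using radial_integral_tendsto[OF sets_f[OF that] integrable_one_energy[OF that] k(1) h5 lim0] .
  \<comment> \<open>Measurability of \<open>total_weight\<close> is known only after multiplication
    by the indicator of a bounded interval; times outside it belong to \<open>G\<close>
    harmlessly.\<close>
  define G where "G = {s. total_weight s * indicator {0..t} s < \<infinity>}"
  have G [measurable]: "G \<in> sets lborel"
    unfolding G_def using total_weight_measurable[of t] by measurable
  have inG: "s \<in> {0..t} \<Longrightarrow> s \<in> G \<longleftrightarrow> total_weight s < \<infinity>" for s
    by (simp add: G_def)
  define u where "u n s = indicator G s * (indicator {0..t} s *\<^sub>R landau_weak_rhs \<gamma> (radial (k n)) (f s))" for n s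
  \<comment> \<open>The constant is 16 from \<open>tame_abs_landau_weak_rhs_le\<close> times the
    truncated tameness constant 5 C.\<close>
  define w where "w s = 80 * C * enn2real (total_weight s * indicator {0..t} s)" for s
  have u_lim: "(\<lambda>n. u n s) \<longlonglongrightarrow> indicator {0..t} s *\<^sub>R dissipation h s" for s
  proof (cases "s \<in> {0..t} \<and> total_weight s < \<infinity>")
    case True
    interpret weighted_prob "f s" \<gamma>
      using True by (intro weighted_prob_f) auto
    show ?thesis
      using landau_weak_rhs_tendsto[OF k(1) h5 lim1 lim2] True
      by (simp add: u_def inG dissipation_def)
  next
    case False
    then have "u n s = 0" for n
      by (cases "s \<in> {0..t}") (auto simp: u_def inG)
    moreover have "indicator {0..t} s *\<^sub>R dissipation h s = 0"
      using False by (auto simp: dissipation_def)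
    ultimately show ?thesis
      by (simp only: tendsto_const)
  qed
  have u_meas: "u n \<in> borel_measurable lborel" for n
    using weak_set_integrable[OF k(2) t, of n] unfolding u_def[abs_def] set_integrable_def
    by (intro borel_measurable_times) auto
  have u_bound: "norm (u n s) \<le> w s" for n s
  proof (cases "s \<in> {0..t} \<and> total_weight s < \<infinity>")
    case True
    interpret weighted_prob "f s" \<gamma>
      using True by (intro weighted_prob_f) auto
    have "(\<integral>v. weight \<gamma> v \<partial>f s) = enn2real (total_weight s)"
      unfolding total_weight_def using integrable_weight weight_nonneg
      by (intro integral_eq_nn_integral) auto
    then show ?thesis
      using tame_abs_landau_weak_rhs_le[OF k(1), of n] True by (simp add: u_def inG w_def)
  next
    case False
    then have "u n s = 0"
      by (cases "s \<in> {0..t}") (auto simp: u_def inG)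
    then show ?thesis
      using C by (simp add: w_def)
  qed
  have w_int: "integrable lborel w"
    unfolding w_def[abs_def]
  proof (intro integrable_mult_right integrableI_nonneg)
    have "(\<integral>\<^sup>+s. ennreal (enn2real (total_weight s * indicator {0..t} s)) \<partial>lborel)
        \<le> (\<integral>\<^sup>+s. total_weight s * indicator {0..t} s \<partial>lborel)"
      by (intro nn_integral_mono) (metis ennreal_enn2real_if order_refl zero_le)
    also have "\<dots> < \<infinity>"
      by (rule total_weight_integral_finite)
    finally show "(\<integral>\<^sup>+s. ennreal (enn2real (total_weight s * indicator {0..t} s)) \<partial>lborel) < \<infinity>" .
    show "(\<lambda>s. enn2real (total_weight s * indicator {0..t} s)) \<in> borel_measurable lborel"
      using total_weight_measurable[of t] by (rule borel_measurable_enn2real)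
  qed simp
  have lim_meas: "(\<lambda>s. indicator {0..t} s *\<^sub>R dissipation h s) \<in> borel_measurable lborel"
    using u_meas u_lim by (rule borel_measurable_LIMSEQ_real[rotated])
  show "set_integrable lborel {0..t} (dissipation h)"
    unfolding set_integrable_def
    by (rule integrable_dominated_convergence[where s = u, OF lim_meas u_meas w_int])
       (rule AE_I2, rule u_lim u_bound)+
  have dom: "(\<lambda>n. integral\<^sup>L lborel (u n)) \<longlonglongrightarrow> (LINT s:{0..t}|lborel. dissipation h s)"
    unfolding set_lebesgue_integral_def
    by (rule integral_dominated_convergence[where s = u, OF lim_meas u_meas w_int])
       (rule AE_I2, rule u_lim u_bound)+
  have "integral\<^sup>L lborel (u n) = (LINT s:{0..t}|lborel. landau_weak_rhs \<gamma> (radial (k n)) (f s))" for n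
    unfolding set_lebesgue_integral_def
  proof (rule integral_cong_AE)
    show "AE s in lborel. u n s = indicator {0..t} s *\<^sub>R landau_weak_rhs \<gamma> (radial (k n)) (f s)"
      using AE_total_weight_finite[of t]
      by eventually_elim (auto simp: u_def inG indicator_def)
    show "(\<lambda>s. indicator {0..t} s *\<^sub>R landau_weak_rhs \<gamma> (radial (k n)) (f s)) \<in> borel_measurable lborel"
      using weak_set_integrable[OF k(2) t, of n] unfolding set_integrable_def by auto
  qed (rule u_meas)
  then have "integral\<^sup>L lborel (u n) = (\<integral>v. k n (v \<bullet> v) \<partial>f t) - (\<integral>v. k n (v \<bullet> v) \<partial>f 0)" for n
    using weak_equation[OF k(2) t, of n] by simp
  then have "(\<lambda>n. integral\<^sup>L lborel (u n)) \<longlonglongrightarrow> (\<integral>v. h (v \<bullet> v) \<partial>f t) - (\<integral>v. h (v \<bullet> v) \<partial>f 0)"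
    using tendsto_diff[OF int_lim[OF t] int_lim[of 0]] by simp
  from LIMSEQ_unique[OF this dom]
  show "(\<integral>v. h (v \<bullet> v) \<partial>f t) = (\<integral>v. h (v \<bullet> v) \<partial>f 0) + (LINT s:{0..t}|lborel. dissipation h s)"
    by simp
qed

end

section \<open>A regularised exponential\<close>

text \<open>
  \<open>soft_exp \<epsilon>\<close> tends to \<open>exp\<close> as \<open>\<epsilon>\<close> tends to \<open>0\<close>, but grows only linearly.
\<close>

definition soft_exp :: "real \<Rightarrow> real \<Rightarrow> real" where
  "soft_exp \<epsilon> z = ln (1 + \<epsilon> * exp z) / \<epsilon>"

text \<open>The derivative of \<open>soft_exp\<close>; \<open>logistic1\<close> and
  \<open>logistic2\<close> are the next two derivatives.\<close>

definition logistic :: "real \<Rightarrow> real \<Rightarrow> real" where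
  "logistic \<epsilon> z = exp z / (1 + \<epsilon> * exp z)"

definition logistic1 :: "real \<Rightarrow> real \<Rightarrow> real" where
  "logistic1 \<epsilon> z = exp z / (1 + \<epsilon> * exp z) ^ 2"

definition logistic2 :: "real \<Rightarrow> real \<Rightarrow> real" where
  "logistic2 \<epsilon> z = exp z * (1 - \<epsilon> * exp z) / (1 + \<epsilon> * exp z) ^ 3"

lemma mult_exp_minus_le_1: "z * exp (- z) \<le> (1::real)"
proof -
  have "z \<le> exp z"
    using exp_ge_add_one_self[of z] by linarith
  then show ?thesis
    by (simp add: exp_minus divide_simps)
qed

lemma square_mult_exp_minus_le_2: "0 \<le> z \<Longrightarrow> z * (z * exp (- z)) \<le> (2::real)"
  using exp_lower_Taylor_quadratic[of z] by (simp add: exp_minus divide_simps power2_eq_square)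

context
  fixes \<epsilon> :: real
  assumes \<epsilon>: "0 < \<epsilon>"
begin

lemma logistic_denominator_pos: "0 < 1 + \<epsilon> * exp z"
  using \<epsilon> by (intro add_pos_pos) auto

lemma soft_exp_DERIV: "(soft_exp \<epsilon> has_real_derivative logistic \<epsilon> z) (at z)"
  unfolding soft_exp_def[abs_def] logistic_def
  using \<epsilon> logistic_denominator_pos[of z] by (auto intro!: derivative_eq_intros)

lemma logistic_DERIV: "(logistic \<epsilon> has_real_derivative logistic1 \<epsilon> z) (at z)"
proof -
  have "1 + \<epsilon> * exp z \<noteq> 0"
    using logistic_denominator_pos[of z] by linarith
  then show ?thesis
    unfolding logistic_def[abs_def] logistic1_def
    by (auto intro!: derivative_eq_intros simp: field_simps power2_eq_square)
qed

lemma logistic1_DERIV: "(logistic1 \<epsilon> has_real_derivative logistic2 \<epsilon> z) (at z)"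
proof -
  have *: "1 + \<epsilon> * exp z \<noteq> 0"
    using logistic_denominator_pos[of z] by linarith
  have "((\<lambda>z. exp z / (1 + \<epsilon> * exp z) ^ 2) has_real_derivative
      (exp z * (1 + \<epsilon> * exp z) ^ 2 - exp z * (2 * (1 + \<epsilon> * exp z) * (\<epsilon> * exp z))) /
      ((1 + \<epsilon> * exp z) ^ 2 * (1 + \<epsilon> * exp z) ^ 2)) (at z)"
    using * by (auto intro!: derivative_eq_intros)
  moreover have "(E * A ^ 2 - E * (2 * A * B)) / (A ^ 2 * A ^ 2) = E * (A - 2 * B) / A ^ 3" if "A \<noteq> 0" for E A B :: real
    using that by (simp add: divide_simps power2_eq_square power3_eq_cube) (simp add: algebra_simps)
  note this[OF *, of "exp z" "\<epsilon> * exp z"]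
  moreover have "1 + \<epsilon> * exp z - 2 * (\<epsilon> * exp z) = 1 - \<epsilon> * exp z"
    by simp
  ultimately show ?thesis
    by (simp only: logistic1_def[abs_def] logistic2_def)
qed

text \<open>In this form monotonicity and the bound 1 / \<epsilon> are visible, and differences
  factor.\<close>

lemma logistic_eq: "logistic \<epsilon> z = 1 / (exp (- z) + \<epsilon>)"
  by (simp add: logistic_def exp_minus field_simps)

lemma logistic_pos: "0 < logistic \<epsilon> z"
  using logistic_denominator_pos[of z] by (simp add: logistic_def)

lemma logistic_le: "logistic \<epsilon> z \<le> 1 / \<epsilon>"
  unfolding logistic_eq using \<epsilon> by (intro divide_left_mono mult_pos_pos add_pos_pos) auto

lemma logistic_le_exp: "logistic \<epsilon> z \<le> exp z"
  unfolding logistic_def using \<epsilon> logistic_denominator_pos[of z] by (simp add: divide_le_eq)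

lemma logistic_mono: "y \<le> z \<Longrightarrow> logistic \<epsilon> y \<le> logistic \<epsilon> z"
  unfolding logistic_eq using \<epsilon> by (intro divide_left_mono mult_pos_pos add_pos_pos) auto

lemma logistic1_eq: "logistic1 \<epsilon> z = exp (- z) * (logistic \<epsilon> z * logistic \<epsilon> z)"
  by (simp add: logistic1_def logistic_def power2_eq_square exp_minus)

lemma logistic1_nonneg: "0 \<le> logistic1 \<epsilon> z"
  by (simp add: logistic1_def)

text \<open>This gives h2 <= b h1 for h r = \<open>soft_exp \<epsilon> (b * r)\<close> with a
  constant free of \<epsilon>: the regularisation does not worsen the cross term compared with the
  true exponential.\<close>

lemma logistic1_le_logistic: "logistic1 \<epsilon> z \<le> logistic \<epsilon> z"
proof -
  have "exp (- z) * logistic \<epsilon> z \<le> 1"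
    using mult_left_mono[OF logistic_le_exp[of z], of "exp (- z)"] by (simp flip: exp_add)
  from mult_right_mono[OF this, of "logistic \<epsilon> z"] show ?thesis
    using logistic_pos[of z] by (simp add: logistic1_eq mult_ac)
qed

text \<open>For fixed \<epsilon> the second derivative decays exponentially, so polynomial multiples
  of it stay bounded, as tameness requires. These constants blow up as \<epsilon> tends to 0, but
  they do not enter the final bound.\<close>

lemma logistic1_le_exp_minus: "logistic1 \<epsilon> z \<le> exp (- z) / \<epsilon> ^ 2"
proof -
  have "logistic \<epsilon> z * logistic \<epsilon> z \<le> (1 / \<epsilon>) * (1 / \<epsilon>)"
    using logistic_pos[of z] logistic_le[of z] \<epsilon> by (intro mult_mono) auto
  from mult_left_mono[OF this, of "exp (- z)"] show ?thesis
    by (simp add: logistic1_eq power2_eq_square)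
qed

lemma abs_logistic2_le: "\<bar>logistic2 \<epsilon> z\<bar> \<le> logistic1 \<epsilon> z"
proof -
  define A where "A = 1 + \<epsilon> * exp z"
  have A: "0 < A"
    unfolding A_def by (rule logistic_denominator_pos)
  have "0 \<le> \<epsilon> * exp z"
    using \<epsilon> by simp
  then have "\<bar>1 - \<epsilon> * exp z\<bar> \<le> A"
    unfolding A_def by linarith
  then have "exp z * \<bar>1 - \<epsilon> * exp z\<bar> / A ^ 3 \<le> exp z * A / A ^ 3"
    using A by (intro divide_right_mono mult_left_mono) auto
  then show ?thesis
    using A by (simp add: logistic2_def logistic1_def abs_mult power2_eq_square power3_eq_cube A_def[symmetric])
qed

lemma soft_exp_convex:
  assumes "y \<le> z"
  shows "soft_exp \<epsilon> z - soft_exp \<epsilon> y \<le> (z - y) * logistic \<epsilon> z"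
    "0 \<le> soft_exp \<epsilon> z - soft_exp \<epsilon> y"
proof -
  have "(soft_exp \<epsilon> z - soft_exp \<epsilon> y \<le> (z - y) * logistic \<epsilon> z) \<and> 0 \<le> soft_exp \<epsilon> z - soft_exp \<epsilon> y"
  proof (cases "y = z")
    case False
    then obtain x where x: "y < x" "x < z" "soft_exp \<epsilon> z - soft_exp \<epsilon> y = (z - y) * logistic \<epsilon> x"
      using MVT2[of y z "soft_exp \<epsilon>" "logistic \<epsilon>"] soft_exp_DERIV assms by auto
    then show ?thesis
      using logistic_mono[of x z] logistic_pos[of x] by (auto intro!: mult_left_mono)
  qed simp
  then show "soft_exp \<epsilon> z - soft_exp \<epsilon> y \<le> (z - y) * logistic \<epsilon> z"
    "0 \<le> soft_exp \<epsilon> z - soft_exp \<epsilon> y"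
    by auto
qed

lemma soft_exp_0_le_1: "soft_exp \<epsilon> 0 \<le> 1"
  using ln_add_one_self_le_self[of \<epsilon>] \<epsilon> by (simp add: soft_exp_def)

lemma soft_exp_nonneg: "0 \<le> soft_exp \<epsilon> z"
  using \<epsilon> by (simp add: soft_exp_def)

text \<open>The factor exp (- y) is kept because it later absorbs x^2, which makes the error of a
  change of rate quadratic uniformly in x.\<close>

lemma logistic_lipschitz:
  assumes "0 \<le> y" "y \<le> z"
  shows "logistic \<epsilon> z - logistic \<epsilon> y \<le> exp (- y) * (z - y) / \<epsilon> ^ 2"
proof -
  have "exp (- y) * exp (- (z - y)) = exp (- z)"
    by (simp flip: exp_add)
  moreover have "1 - exp (- (z - y)) \<le> z - y"
    using exp_ge_add_one_self[of "- (z - y)"] by linarith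
  then have "exp (- y) * (1 - exp (- (z - y))) \<le> exp (- y) * (z - y)"
    by (intro mult_left_mono) auto
  ultimately have 1: "exp (- y) - exp (- z) \<le> exp (- y) * (z - y)"
    by (simp add: algebra_simps)
  have "logistic \<epsilon> z - logistic \<epsilon> y = (exp (- y) - exp (- z)) * (logistic \<epsilon> y * logistic \<epsilon> z)"
    unfolding logistic_eq using \<epsilon> add_pos_pos[of "exp (- y)" \<epsilon>] add_pos_pos[of "exp (- z)" \<epsilon>]
    by (simp add: divide_simps)
  also have "\<dots> \<le> (exp (- y) * (z - y)) * ((1 / \<epsilon>) * (1 / \<epsilon>))"
    using 1 logistic_le[of y] logistic_le[of z] logistic_pos[of y] logistic_pos[of z] assms \<epsilon>
    by (intro mult_mono) auto
  finally show ?thesis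
    by (simp add: power2_eq_square)
qed

text \<open>The difference on the right equals (exp (- y) - exp (- z)) times the product of both
  logistic values, and the one at y is at least 1/2 because exp (- y) + \<epsilon> <= 2. Hence the
  dissipation has a lower bound uniform in \<epsilon>.\<close>

lemma logistic_diff_ge:
  assumes "\<epsilon> \<le> 1" "0 \<le> y" "y \<le> z"
  shows "(exp (- y) - exp (- z)) * logistic \<epsilon> z \<le> 2 * (logistic \<epsilon> z - logistic \<epsilon> y)"
proof -
  have "exp (- y) + \<epsilon> \<le> 2" 
    using assms by (intro order_trans[OF add_mono[of "exp (- y)" 1 \<epsilon> 1]]) auto
  then have "1 \<le> 2 * logistic \<epsilon> y"
    unfolding logistic_eq using \<epsilon> add_pos_pos[of "exp (- y)" \<epsilon>] by (simp add: divide_simps)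
  then have "((exp (- y) - exp (- z)) * logistic \<epsilon> z) * 1 \<le> ((exp (- y) - exp (- z)) * logistic \<epsilon> z) * (2 * logistic \<epsilon> y)"
    using assms logistic_pos[of z] by (intro mult_left_mono) auto
  also have "\<dots> = 2 * (logistic \<epsilon> z - logistic \<epsilon> y)"
    unfolding logistic_eq using \<epsilon> add_pos_pos[of "exp (- y)" \<epsilon>] add_pos_pos[of "exp (- z)" \<epsilon>]
    by (simp add: divide_simps)
  finally show ?thesis by simp
qed

lemma moments_logistic1:
  assumes "0 \<le> z"
  shows "logistic1 \<epsilon> z \<le> 1 / \<epsilon> ^ 2" "z * logistic1 \<epsilon> z \<le> 1 / \<epsilon> ^ 2" "z * (z * logistic1 \<epsilon> z) \<le> 2 / \<epsilon> ^ 2"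
proof -
  have *: "c * logistic1 \<epsilon> z \<le> d / \<epsilon> ^ 2" if "0 \<le> c" "c * exp (- z) \<le> d" for c d
  proof -
    have "c * logistic1 \<epsilon> z \<le> c * (exp (- z) / \<epsilon> ^ 2)"
      using that logistic1_le_exp_minus by (intro mult_left_mono)
    also have "\<dots> \<le> d / \<epsilon> ^ 2"
      using divide_right_mono[OF that(2), of "\<epsilon> ^ 2"] by simp
    finally show ?thesis .
  qed
  show "logistic1 \<epsilon> z \<le> 1 / \<epsilon> ^ 2"
    using *[of 1 1] assms by simp
  show "z * logistic1 \<epsilon> z \<le> 1 / \<epsilon> ^ 2"
    using assms mult_exp_minus_le_1 by (intro *)
  show "z * (z * logistic1 \<epsilon> z) \<le> 2 / \<epsilon> ^ 2"
    using *[of "z * z" 2] assms square_mult_exp_minus_le_2 by (simp add: mult.assoc)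
qed

lemma continuous_on_logistics:
  "continuous_on UNIV (logistic1 \<epsilon>)" "continuous_on UNIV (logistic2 \<epsilon>)"
  using logistic_denominator_pos less_irrefl
  unfolding logistic1_def[abs_def] logistic2_def[abs_def]
  by (auto intro!: continuous_intros) (metis less_irrefl)+

lemma tame_soft_exp:
  assumes b: "0 < b" "b \<le> 1" and "\<epsilon> \<le> 1"
  shows "tame (2 / \<epsilon> ^ 2) (\<lambda>r. soft_exp \<epsilon> (b * r)) (\<lambda>r. b * logistic \<epsilon> (b * r)) (\<lambda>r. b * b * logistic1 \<epsilon> (b * r))"
proof -
  have chain: "((\<lambda>r. F (b * r)) has_real_derivative b * F' (b * r)) (at r)"
    if "\<And>z. (F has_real_derivative F' z) (at z)" for F F' r
    using DERIV_chain2[OF that DERIV_cmult_Id] by (simp only: mult.commute[of b "F' (b * r)"])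
  have "1 \<le> 1 / \<epsilon>" "1 / \<epsilon> \<le> 1 / \<epsilon> ^ 2"
    using \<epsilon> assms by (auto simp: divide_simps power2_eq_square)
  moreover have "2 / \<epsilon> ^ 2 = 1 / \<epsilon> ^ 2 + 1 / \<epsilon> ^ 2"
    by simp
  ultimately have inv: "1 \<le> 1 / \<epsilon> ^ 2" "1 / \<epsilon> \<le> 1 / \<epsilon> ^ 2" "1 / \<epsilon> \<le> 2 / \<epsilon> ^ 2"
    by linarith+
  show ?thesis
    unfolding tame_def C2_radial_def
  proof (intro conjI allI impI)
    fix r :: real
    show "((\<lambda>r. soft_exp \<epsilon> (b * r)) has_real_derivative b * logistic \<epsilon> (b * r)) (at r)"
      by (rule chain[OF soft_exp_DERIV])
    show "((\<lambda>r. b * logistic \<epsilon> (b * r)) has_real_derivative b * b * logistic1 \<epsilon> (b * r)) (at r)"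
      using DERIV_cmult[OF chain[OF logistic_DERIV], of b r] by (simp add: mult.assoc)
    show "continuous_on {- 1<..} (\<lambda>r. b * b * logistic1 \<epsilon> (b * r))"
      by (intro continuous_intros continuous_on_compose2[OF continuous_on_logistics(1)]) auto
  next
    fix r :: real assume r: "0 \<le> r"
    define z where "z = b * r"
    have z: "0 \<le> z" "z \<le> r"
      using b r mult_right_mono[of b 1 r] by (auto simp: z_def)
    have "soft_exp \<epsilon> z \<le> 1 + z * (1 / \<epsilon>)"
      using soft_exp_convex(1)[OF z(1)] soft_exp_0_le_1 mult_left_mono[OF logistic_le z(1), of z] by simp
    also have "z * (1 / \<epsilon>) \<le> r * (2 / \<epsilon> ^ 2)"
      using z inv \<epsilon> by (intro mult_mono) auto
    also have "1 + r * (2 / \<epsilon> ^ 2) \<le> 2 / \<epsilon> ^ 2 * (1 + r)"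
    proof -
      have "1 \<le> 2 / \<epsilon> ^ 2"
        using inv by linarith
      then show ?thesis
        unfolding distrib_left by (simp only: mult_1_right mult.commute[of r] add_right_mono)
    qed
    finally show "\<bar>soft_exp \<epsilon> (b * r)\<bar> \<le> 2 / \<epsilon> ^ 2 * (1 + r)"
      using soft_exp_nonneg[of z] by (simp add: z_def)
    have "b * logistic \<epsilon> z \<le> 1 * (1 / \<epsilon>)"
      using b logistic_le[of z] logistic_pos[of z] by (intro mult_mono) auto
    then show "\<bar>b * logistic \<epsilon> (b * r)\<bar> \<le> 2 / \<epsilon> ^ 2"
      using b logistic_pos[of z] inv by (simp add: z_def abs_mult)
    have "(1 + r) * (b * b * logistic1 \<epsilon> z) = b * (b * logistic1 \<epsilon> z) + b * (z * logistic1 \<epsilon> z)"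
      by (simp add: z_def algebra_simps)
    also have "\<dots> \<le> 1 * (1 * (1 / \<epsilon> ^ 2)) + 1 * (1 / \<epsilon> ^ 2)"
      using b moments_logistic1[OF z(1)] logistic1_nonneg[of z] z by (intro add_mono mult_mono) auto
    finally show "(1 + r) * \<bar>b * b * logistic1 \<epsilon> (b * r)\<bar> \<le> 2 / \<epsilon> ^ 2"
      using b logistic1_nonneg[of z] by (simp add: z_def abs_mult)
  qed
qed

text \<open>This function is the derivative of \<open>soft_exp \<epsilon> (b * r)\<close> in b, so
  its integral measures the cost of raising the rate; tameness makes that integral continuous in
  time.\<close>

lemma tame_mult_logistic:
  assumes b: "0 < b" "b \<le> 1" and "\<epsilon> \<le> 1"
  shows "tame (7 / \<epsilon> ^ 2) (\<lambda>r. r * logistic \<epsilon> (b * r))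
    (\<lambda>r. logistic \<epsilon> (b * r) + b * r * logistic1 \<epsilon> (b * r))
    (\<lambda>r. 2 * b * logistic1 \<epsilon> (b * r) + b * b * r * logistic2 \<epsilon> (b * r))"
proof -
  have chain: "((\<lambda>r. F (b * r)) has_real_derivative b * F' (b * r)) (at r)"
    if "\<And>z. (F has_real_derivative F' z) (at z)" for F F' r
    using DERIV_chain2[OF that DERIV_cmult_Id] by (simp only: mult.commute[of b "F' (b * r)"])
  have inv: "1 / \<epsilon> \<le> 1 / \<epsilon> ^ 2"
    using \<epsilon> assms by (auto simp: divide_simps power2_eq_square)
  show ?thesis
    unfolding tame_def C2_radial_def
  proof (intro conjI allI impI)
    fix r :: real
    show "((\<lambda>r. r * logistic \<epsilon> (b * r)) has_real_derivative logistic \<epsilon> (b * r) + b * r * logistic1 \<epsilon> (b * r)) (at r)"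
      by (rule derivative_eq_intros chain[OF logistic_DERIV] refl)+ (simp add: algebra_simps)
    show "((\<lambda>r. logistic \<epsilon> (b * r) + b * r * logistic1 \<epsilon> (b * r)) has_real_derivative
        2 * b * logistic1 \<epsilon> (b * r) + b * b * r * logistic2 \<epsilon> (b * r)) (at r)"
      by (rule derivative_eq_intros chain[OF logistic_DERIV] chain[OF logistic1_DERIV] refl)+ (simp add: algebra_simps)
    show "continuous_on {- 1<..} (\<lambda>r. 2 * b * logistic1 \<epsilon> (b * r) + b * b * r * logistic2 \<epsilon> (b * r))"
      by (intro continuous_intros continuous_on_compose2[OF continuous_on_logistics(1)]
          continuous_on_compose2[OF continuous_on_logistics(2)]) auto
  next
    fix r :: real assume r: "0 \<le> r"
    define z where "z = b * r"
    have z: "0 \<le> z"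
      using b r by (auto simp: z_def)
    have "r * logistic \<epsilon> z \<le> (1 + r) * (7 / \<epsilon> ^ 2)"
      using r logistic_le[of z] logistic_pos[of z] inv by (intro mult_mono) auto
    then show "\<bar>r * logistic \<epsilon> (b * r)\<bar> \<le> 7 / \<epsilon> ^ 2 * (1 + r)"
      using r logistic_pos[of z] by (simp add: z_def abs_mult mult_ac)
    have "0 \<le> z * logistic1 \<epsilon> z"
      using z logistic1_nonneg[of z] by simp
    then show "\<bar>logistic \<epsilon> (b * r) + b * r * logistic1 \<epsilon> (b * r)\<bar> \<le> 7 / \<epsilon> ^ 2"
      using logistic_pos[of z] logistic_le[of z] moments_logistic1[OF z] inv by (simp add: z_def)
    define E where "E = 1 / \<epsilon> ^ 2"
    have E: "0 \<le> E"
      by (simp add: E_def)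
    have "(1 + r) * \<bar>2 * b * logistic1 \<epsilon> z + b * z * logistic2 \<epsilon> z\<bar>
        \<le> (1 + r) * (2 * b * logistic1 \<epsilon> z + b * z * logistic1 \<epsilon> z)"
    proof (intro mult_left_mono)
      have "\<bar>2 * b * logistic1 \<epsilon> z\<bar> = 2 * b * logistic1 \<epsilon> z"
        using b logistic1_nonneg[of z] by simp
      moreover have "\<bar>b * z * logistic2 \<epsilon> z\<bar> \<le> b * z * logistic1 \<epsilon> z"
        using b z abs_logistic2_le[of z] by (simp add: abs_mult mult_left_mono)
      ultimately show "\<bar>2 * b * logistic1 \<epsilon> z + b * z * logistic2 \<epsilon> z\<bar> \<le> 2 * b * logistic1 \<epsilon> z + b * z * logistic1 \<epsilon> z"
        by linarith
    qed (use r in simp)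
    also have "\<dots> = b * (2 * logistic1 \<epsilon> z) + b * (z * logistic1 \<epsilon> z) + 2 * (z * logistic1 \<epsilon> z) + z * (z * logistic1 \<epsilon> z)"
      by (simp add: z_def algebra_simps)
    \<comment> \<open>The four summands contribute 2 + 1 + 2 + 2, the first two by b <= 1.\<close>
    also have "\<dots> \<le> 7 * E"
    proof -
      have "b * (2 * logistic1 \<epsilon> z) \<le> 2 * logistic1 \<epsilon> z" "b * (z * logistic1 \<epsilon> z) \<le> z * logistic1 \<epsilon> z"
        using b z logistic1_nonneg[of z] by (intro mult_left_le_one_le; simp)+
      moreover have "logistic1 \<epsilon> z \<le> E" "z * logistic1 \<epsilon> z \<le> E" "z * (z * logistic1 \<epsilon> z) \<le> 2 * E"
        using moments_logistic1[OF z] by (simp_all add: E_def)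
      ultimately show ?thesis
        by linarith
    qed
    finally show "(1 + r) * \<bar>2 * b * logistic1 \<epsilon> (b * r) + b * b * r * logistic2 \<epsilon> (b * r)\<bar> \<le> 7 / \<epsilon> ^ 2"
      by (simp add: z_def E_def mult.assoc)
  qed
qed

text \<open>The expression is the coefficient of b x^(1 + \<gamma>/2) in the collision integrand: 8
  b M from the cross term against 3/8 from \<open>gain\<close> with R = 2 M. With z = b x and g the
  logistic value at z, b M <= min(1, z) / 256 bounds the cross term by min(1, z) g / 32, while the
  gain is at least a larger multiple of min(1, z) g.\<close>

lemma loss_absorbs_growth:
  assumes \<epsilon>1: "\<epsilon> \<le> 1" and M: "1 \<le> M" and b: "0 < b" "b * (256 * M) \<le> 1"
    and x: "256 * M \<le> x"
  shows "8 * b * M * logistic \<epsilon> (b * x) - 3 / 8 * (logistic \<epsilon> (b * x) - logistic \<epsilon> (b * (2 * M))) \<le> 0"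
    "1 \<le> b * x \<Longrightarrow>
      8 * b * M * logistic \<epsilon> (b * x) - 3 / 8 * (logistic \<epsilon> (b * x) - logistic \<epsilon> (b * (2 * M)))
      \<le> - (1 / 32) * logistic \<epsilon> (b * x)"
proof -
  define g where "g = logistic \<epsilon> (b * x)"
  define y where "y = b * (2 * M)"
  define z where "z = b * x"
  define \<beta> where "\<beta> = b * M"
  have g: "0 < g"
    unfolding g_def by (rule logistic_pos)
  have \<beta>: "0 < \<beta>" "256 * \<beta> \<le> 1" "256 * \<beta> \<le> z" "y = 2 * \<beta>"
    using b M x mult_left_mono[OF x, of b] by (auto simp: \<beta>_def z_def y_def)
  have d: "(exp (- y) - exp (- z)) * g \<le> 2 * (g - logistic \<epsilon> y)"
    unfolding g_def z_def[symmetric] using \<beta> by (intro logistic_diff_ge \<epsilon>1) auto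
  define Q where "Q = \<beta> * g"
  have small: "Q \<le> z * g / 256" "Q \<le> g / 256"
    using \<beta> g mult_right_mono[of \<beta> "z / 256" g] mult_right_mono[of \<beta> "1 / 256" g]
    by (simp_all add: Q_def)
  have E: "8 * b * M * logistic \<epsilon> (b * x) = 8 * Q"
    by (simp add: Q_def g_def \<beta>_def)
  \<comment> \<open>For z >= 1 the difference exp (- y) - exp (- z) is at least 127/128 - 1/2, which
    leaves a surplus of g / 32 after the cross term is paid.\<close>
  have zpos: "1 / 32 * g \<le> 3 / 8 * (g - logistic \<epsilon> y) - 8 * Q" if "1 \<le> z"
  proof -
    have "2 \<le> exp (1::real)"
      using exp_ge_add_one_self[of "1::real"] by simp
    then have "exp (- 1) \<le> (1 / 2 :: real)"
      by (simp add: exp_minus divide_simps)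
    moreover have "exp (- z) \<le> exp (- 1)"
      using that by simp
    moreover have "1 - 1 / 128 \<le> exp (- y)"
      using exp_ge_add_one_self[of "- y"] \<beta> by linarith
    ultimately have "49 / 100 \<le> exp (- y) - exp (- z)"
      by linarith
    then have "49 / 100 * g \<le> (exp (- y) - exp (- z)) * g"
      using g by (intro mult_right_mono) auto
    with d have "49 / 100 * g \<le> 2 * (g - logistic \<epsilon> y)"
      by (rule order_trans[rotated])
    then show ?thesis
      using small(2) g by linarith
  qed
  then show "1 \<le> b * x \<Longrightarrow>
      8 * b * M * logistic \<epsilon> (b * x) - 3 / 8 * (logistic \<epsilon> (b * x) - logistic \<epsilon> (b * (2 * M)))
      \<le> - (1 / 32) * logistic \<epsilon> (b * x)"
    unfolding E unfolding g_def[symmetric] unfolding y_def[symmetric] z_def[symmetric] by linarith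
  show "8 * b * M * logistic \<epsilon> (b * x) - 3 / 8 * (logistic \<epsilon> (b * x) - logistic \<epsilon> (b * (2 * M))) \<le> 0"
  proof (cases "1 \<le> z")
    case True
    then show ?thesis
      using zpos g unfolding E unfolding g_def[symmetric] y_def[symmetric] by linarith
  next
    \<comment> \<open>For z < 1 both sides are linear in z: y <= z / 128 and exp (- z) >=
      1/3.\<close>
    case False
    have "exp (1::real) \<le> 3"
      by (rule exp_le)
    then have "1 / 3 \<le> exp (- 1 :: real)"
      by (simp add: exp_minus divide_simps)
    also have "\<dots> \<le> exp (- z)"
      using False by simp
    finally have e: "1 / 3 \<le> exp (- z)" .
    have "exp (- z) * exp (z - y) = exp (- y)"
      by (simp flip: exp_add)
    moreover have "z - y \<le> exp (z - y) - 1"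
      using exp_ge_add_one_self[of "z - y"] by linarith
    then have "exp (- z) * (z - y) \<le> exp (- z) * (exp (z - y) - 1)"
      by (intro mult_left_mono) auto
    moreover have "1 / 3 * (127 / 128 * z) \<le> exp (- z) * (z - y)"
      using e \<beta> by (intro mult_mono) auto
    ultimately have "1 / 3 * (127 / 128 * z) \<le> exp (- y) - exp (- z)"
      by (simp add: algebra_simps)
    from mult_right_mono[OF this, of g]
    have "1 / 3 * (127 / 128) * (z * g) \<le> (exp (- y) - exp (- z)) * g"
      using g by simp
    moreover have "0 \<le> z * g"
      using g \<beta> by simp
    ultimately show ?thesis
      using d small unfolding E unfolding g_def[symmetric] y_def[symmetric] by linarith
  qed
qed

text \<open>Three ranges of x. Below 256 M everything is bounded. Above it, as long as b x <= 1 + b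
  X, the left side is nonpositive and \<open>?R\<close> is nonnegative. Beyond that, a surplus of
  1/32 of the dissipation pays for the term -k b x g in \<open>?R\<close>, where g is the logistic
  value at b x.\<close>

lemma collision_pointwise:
  assumes \<gamma>: "0 < \<gamma>" and \<epsilon>1: "\<epsilon> \<le> 1" and M: "1 \<le> M" and b: "0 < b" "b * (256 * M) \<le> 1"
    and k: "0 < k" and x: "0 \<le> x"
  shows "8 * b * M * (b * logistic \<epsilon> (b * x) * x powr (1 + \<gamma> / 2))
      - 3 / 8 * gain \<gamma> (\<lambda>r. b * logistic \<epsilon> (b * r)) (2 * M) x
    \<le> exp 1 * (256 * M) powr (1 + \<gamma> / 2)
      + k * b * (exp (1 + b * (32 * k) powr (2 / \<gamma>)) * x - x * logistic \<epsilon> (b * x))"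
    (is "?L \<le> ?C + ?R")
proof -
  define g where "g = logistic \<epsilon> (b * x)"
  \<comment> \<open>The threshold solves X^(\<gamma>/2) = 32 k.\<close>
  define X where "X = (32 * k) powr (2 / \<gamma>)"
  define P where "P = x powr (1 + \<gamma> / 2)"
  have g: "0 < g"
    unfolding g_def by (rule logistic_pos)
  have P: "0 \<le> P"
    by (simp add: P_def)
  have C: "0 \<le> ?C"
    by simp
  \<comment> \<open>The logistic value is at most exp (b x), so up to this point the subtracted
    moment is covered by the added exponential.\<close>
  have R: "0 \<le> ?R" if "b * x \<le> 1 + b * X"
  proof -
    have "g \<le> exp (b * x)"
      unfolding g_def by (rule logistic_le_exp)
    also have "\<dots> \<le> exp (1 + b * X)"
      using that by simp
    finally have "x * g \<le> exp (1 + b * X) * x"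
      using x by (simp only: mult.commute[of x g] mult_right_mono)
    then show ?thesis
      using k b by (simp add: X_def g_def)
  qed
  have bX: "0 \<le> b * X"
    using b by (simp add: X_def)
  show ?thesis
  proof (cases "x < 256 * M")
    case True
    have bx: "b * x \<le> 1"
      using True b mult_left_mono[of x "256 * M" b] by linarith
    have "?L \<le> 8 * b * M * (b * g * P)"
    proof -
      have "0 \<le> gain \<gamma> (\<lambda>r. b * logistic \<epsilon> (b * r)) (2 * M) x"
        unfolding gain_def using M b by (auto intro!: mult_nonneg_nonneg mult_left_mono logistic_mono)
      then show ?thesis
        by (simp add: g_def P_def)
    qed
    also have "\<dots> = (8 * b * (b * M)) * (g * P)"
      by simp
    also have "\<dots> \<le> 1 * (exp 1 * (256 * M) powr (1 + \<gamma> / 2))"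
    proof (intro mult_mono)
      have "b \<le> b * (256 * M)"
        using b M by simp
      then have "b \<le> 1"
        using b by linarith
      then have "8 * b * (b * M) \<le> 8 * 1 * (1 / 256)"
        using b M by (intro mult_mono) auto
      then show "8 * b * (b * M) \<le> 1"
        by simp
      have "g \<le> exp (b * x)"
        unfolding g_def by (rule logistic_le_exp)
      then show "g \<le> exp 1"
        using bx order_trans by fastforce
      show "P \<le> (256 * M) powr (1 + \<gamma> / 2)"
        unfolding P_def using True x \<gamma> by (intro powr_mono2) auto
    qed (use g P b M in auto)
    finally show ?thesis
      using R bx bX by linarith
  next
    case False
    then have x': "256 * M \<le> x" by simp
    have L: "?L = b * P * (8 * b * M * g - 3 / 8 * (g - logistic \<epsilon> (b * (2 * M))))"
      using x' M by (simp add: gain_def g_def P_def algebra_simps)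
    show ?thesis
    proof (cases "b * x \<le> 1 + b * X")
      case True
      have "?L \<le> 0"
        unfolding L using loss_absorbs_growth(1)[OF \<epsilon>1 M b x'] b P
        by (intro mult_nonneg_nonpos) (auto simp: g_def)
      then show ?thesis
        using R[OF True] C by linarith
    next
      case False
      then have "1 \<le> b * x"
        using bX by linarith
      then have "?L \<le> b * P * (- (1 / 32) * g)"
        unfolding L g_def using b P by (intro mult_left_mono loss_absorbs_growth(2)[OF \<epsilon>1 M b x']) auto
      also have "\<dots> \<le> - (k * b * (x * g))"
      proof -
        have "b * X \<le> b * x"
          using False by linarith
        then have "X \<le> x"
          using b by simp
        then have "X powr (\<gamma> / 2) \<le> x powr (\<gamma> / 2)"
          using \<gamma> by (intro powr_mono2) (auto simp: X_def)
        moreover have "X powr (\<gamma> / 2) = 32 * k"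
          using \<gamma> k by (simp add: X_def powr_powr)
        ultimately have "x * (32 * k) \<le> x * x powr (\<gamma> / 2)"
          using x by (intro mult_left_mono) auto
        then have "32 * k * x \<le> P"
          using x by (simp add: P_def powr_mult_base mult_ac)
        then have "32 * k * x * (b * g / 32) \<le> P * (b * g / 32)"
          using b g by (intro mult_right_mono) auto
        then show ?thesis
          by (simp add: mult_ac)
      qed
      also have "\<dots> \<le> ?R"
        using k b x by (simp add: g_def algebra_simps)
      finally show ?thesis
        using C by linarith
    qed
  qed
qed

end

section \<open>The collision estimate at a fixed time\<close>

context weighted_prob
begin

text \<open>The symmetrised bound integrates to products of one-variable integrals. Only two facts
  about the measure enter their evaluation: its energy is at most M, and at least half of its mass
  has x <= 2 M. What remains is a single integral, to which \<open>collision_pointwise\<close>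
  applies.\<close>

lemma landau_weak_rhs_soft_exp_le:
  assumes \<epsilon>: "0 < \<epsilon>" "\<epsilon> \<le> 1" and M: "1 \<le> M" "(\<integral>v. v \<bullet> v \<partial>\<mu>) \<le> M"
    and b: "0 < b" "b * (256 * M) \<le> 1" and k: "0 < k"
  shows "landau_weak_rhs \<gamma> (radial (\<lambda>r. soft_exp \<epsilon> (b * r))) \<mu> \<le>
    exp 1 * (256 * M) powr (1 + \<gamma> / 2)
      + k * b * (exp (1 + b * (32 * k) powr (2 / \<gamma>)) * M - (\<integral>v. (v \<bullet> v) * logistic \<epsilon> (b * (v \<bullet> v)) \<partial>\<mu>))"
proof -
  define h where "h r = soft_exp \<epsilon> (b * r)" for r
  define h1 where "h1 r = b * logistic \<epsilon> (b * r)" for r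
  define h2 where "h2 r = b * b * logistic1 \<epsilon> (b * r)" for r
  define F where "F v = h1 (v \<bullet> v) * (v \<bullet> v) powr (1 + \<gamma> / 2)" for v :: "real^3"
  define G where "G v = gain \<gamma> h1 (2 * M) (v \<bullet> v)" for v :: "real^3"
  define J where "J = (indicator {w. w \<bullet> w \<le> 2 * M} :: real^3 \<Rightarrow> real)"
  define E where "E v = v \<bullet> v" for v :: "real^3"
  have "b \<le> b * (256 * M)"
    using b M by simp
  then have b1: "b \<le> 1"
    using b by linarith
  have tame: "tame (2 / \<epsilon> ^ 2) h h1 h2"
    unfolding h_def[abs_def] h1_def[abs_def] h2_def[abs_def] by (intro tame_soft_exp \<epsilon> b b1)
  then have h: "C2_radial h h1 h2"
    by (simp add: tame_def)
  note [measurable] = C2_radial_measurable[OF h]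
  have h1: "0 \<le> h1 r" "r \<le> s \<Longrightarrow> h1 r \<le> h1 s" "h1 r \<le> b / \<epsilon>" for r s
    using b logistic_pos[OF \<epsilon>(1), of "b * r"] logistic_le[OF \<epsilon>(1), of "b * r"]
    by (auto simp: h1_def intro!: mult_left_mono logistic_mono[OF \<epsilon>(1)] mult_nonneg_nonneg)
       (metis mult_left_mono less_imp_le mult.right_neutral times_divide_eq_right)
  have h2: "0 \<le> h2 r" "h2 r \<le> b * h1 r" for r
    using b logistic1_nonneg[OF \<epsilon>(1), of "b * r"] logistic1_le_logistic[OF \<epsilon>(1), of "b * r"]
    by (auto simp: h1_def h2_def)
  have G_nonneg: "0 \<le> G v" for v
    unfolding G_def gain_def using M h1(2)[of "2 * M" "v \<bullet> v"] by auto
  have bound: "(v \<bullet> v) powr (1 + \<gamma> / 2) * c \<le> b / \<epsilon> * weight \<gamma> v" if "0 \<le> c" "c \<le> b / \<epsilon>" for c and v :: "real^3"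
    using mult_mono[OF inner_self_powr_le_weight[OF \<gamma>(1), of v] that(2)] that weight_nonneg[of \<gamma> v]
    by (simp add: mult.commute)
  have F_int: "integrable \<mu> F"
  proof (rule Bochner_Integration.integrable_bound[OF integrable_mult_right[OF integrable_weight, of "b / \<epsilon>"]])
    show "F \<in> borel_measurable \<mu>"
      unfolding F_def by measurable
    show "AE v in \<mu>. norm (F v) \<le> norm (b / \<epsilon> * weight \<gamma> v)"
      using bound[OF h1(1) h1(3)] h1(1) b \<epsilon> weight_nonneg by (simp add: F_def abs_mult mult.commute)
  qed
  have G_le: "G v \<le> b / \<epsilon> * weight \<gamma> v" for v
  proof -
    have "(v \<bullet> v) powr (1 + \<gamma> / 2) * (h1 (v \<bullet> v) - h1 (2 * M)) \<le> (v \<bullet> v) powr (1 + \<gamma> / 2) * h1 (v \<bullet> v)"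
      using h1(1) by (intro mult_left_mono) auto
    then show ?thesis
      using bound[OF h1(1) h1(3), of v "v \<bullet> v"] b \<epsilon> weight_nonneg[of \<gamma> v] by (auto simp: G_def gain_def)
  qed
  have G_int: "integrable \<mu> G"
  proof (rule Bochner_Integration.integrable_bound[OF integrable_mult_right[OF integrable_weight, of "b / \<epsilon>"]])
    show "G \<in> borel_measurable \<mu>"
      unfolding G_def gain_def by measurable
    show "AE v in \<mu>. norm (G v) \<le> norm (b / \<epsilon> * weight \<gamma> v)"
      using G_le G_nonneg by (intro AE_I2) (metis abs_ge_self abs_of_nonneg order_trans real_norm_def)
  qed
  have J_int: "integrable \<mu> J"
    unfolding J_def by (intro integrable_const_bound[of _ 1]) auto
  have E_int: "integrable \<mu> E"
  proof (rule Bochner_Integration.integrable_bound[OF integrable_weight])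
    show "E \<in> borel_measurable \<mu>"
      unfolding E_def by measurable
    show "AE v in \<mu>. norm (E v) \<le> norm (weight \<gamma> v)"
      using inner_self_le_weight[OF \<gamma>(1)] weight_nonneg
      by (intro AE_I2) (simp add: E_def add_increasing order_trans[OF _ inner_self_le_weight[OF \<gamma>(1)]])
  qed
  have E_le: "(\<integral>v. E v \<partial>\<mu>) \<le> M"
    using M by (simp add: E_def)
  \<comment> \<open>Markov's inequality for the energy, which fixes the radius parameter R = 2
    M.\<close>
  have J_ge: "1 / 2 \<le> (\<integral>v. J v \<partial>\<mu>)"
  proof -
    have "(\<integral>v. 1 - E v / (2 * M) \<partial>\<mu>) \<le> (\<integral>v. J v \<partial>\<mu>)"
    proof (rule integral_mono)
      show "1 - E v / (2 * M) \<le> J v" for v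
        using M by (auto simp: E_def J_def indicator_def divide_simps)
    qed (use E_int J_int in auto)
    moreover have "(\<integral>v. 1 - E v / (2 * M) \<partial>\<mu>) = 1 - (\<integral>v. E v \<partial>\<mu>) / (2 * M)"
      using E_int by (simp add: prob_space)
    moreover have "(\<integral>v. E v \<partial>\<mu>) / (2 * M) \<le> 1 / 2"
      using E_le M by (simp add: divide_simps)
    ultimately show ?thesis by linarith
  qed
  define L where "L v w = landau_L \<gamma> (radial h) v w" for v w
  have L_int: "integrable (\<mu> \<Otimes>\<^sub>M \<mu>) (\<lambda>z. L (fst z) (snd z))"
    using tame_landau_L_integrable[OF tame] by (simp add: L_def case_prod_unfold)
  have L_int': "integrable (\<mu> \<Otimes>\<^sub>M \<mu>) (\<lambda>z. L (snd z) (fst z))"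
    using pair.integrable_product_swap[OF L_int] by (simp add: case_prod_unfold)
  have rhs: "landau_weak_rhs \<gamma> (radial h) \<mu> = (\<integral>z. L (fst z) (snd z) \<partial>(\<mu> \<Otimes>\<^sub>M \<mu>))"
    using tame_landau_weak_rhs[OF tame] by (simp add: L_def case_prod_unfold)
  have rhs': "(\<integral>z. L (snd z) (fst z) \<partial>(\<mu> \<Otimes>\<^sub>M \<mu>)) = (\<integral>z. L (fst z) (snd z) \<partial>(\<mu> \<Otimes>\<^sub>M \<mu>))"
    using pair.integral_product_swap[OF borel_measurable_integrable[OF L_int]] by (simp add: case_prod_unfold)
  note pi = product_integral[unfolded case_prod_unfold]
  define U where "U z = 8 * b * (F (fst z) * E (snd z) + E (fst z) * F (snd z))
    - 3 / 4 * (G (fst z) * J (snd z) + J (fst z) * G (snd z))" for z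
  have U: "integrable (\<mu> \<Otimes>\<^sub>M \<mu>) U"
    "(\<integral>z. U z \<partial>(\<mu> \<Otimes>\<^sub>M \<mu>)) = 16 * b * ((\<integral>v. E v \<partial>\<mu>) * (\<integral>v. F v \<partial>\<mu>)) - 3 / 2 * ((\<integral>v. J v \<partial>\<mu>) * (\<integral>v. G v \<partial>\<mu>))"
    unfolding U_def[abs_def] using pi[OF F_int E_int] pi[OF E_int F_int] pi[OF G_int J_int] pi[OF J_int G_int]
    by simp_all
  have "2 * landau_weak_rhs \<gamma> (radial h) \<mu> = (\<integral>z. L (fst z) (snd z) + L (snd z) (fst z) \<partial>(\<mu> \<Otimes>\<^sub>M \<mu>))"
    using L_int L_int' by (simp add: rhs rhs')
  also have "\<dots> \<le> (\<integral>z. U z \<partial>(\<mu> \<Otimes>\<^sub>M \<mu>))"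
  proof (rule integral_mono[OF Bochner_Integration.integrable_add[OF L_int L_int'] U(1)])
    fix z
    show "L (fst z) (snd z) + L (snd z) (fst z) \<le> U z"
      unfolding L_def
      using landau_L_symmetrized_le[OF \<gamma> _ h h1(1,2) h2, of "2 * M" "fst z" "snd z"] M b
      by (simp add: U_def F_def E_def G_def J_def mult_ac)
  qed
  finally have "landau_weak_rhs \<gamma> (radial h) \<mu>
      \<le> 8 * b * ((\<integral>v. E v \<partial>\<mu>) * (\<integral>v. F v \<partial>\<mu>)) - 3 / 4 * ((\<integral>v. J v \<partial>\<mu>) * (\<integral>v. G v \<partial>\<mu>))"
    unfolding U(2) by linarith
  \<comment> \<open>The first coefficient grows to 8 b M by the energy bound; the second shrinks to
    3/8 because only half of the mass is used as collision partners.\<close>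
  also have "\<dots> \<le> 8 * b * (M * (\<integral>v. F v \<partial>\<mu>)) - 3 / 4 * (1 / 2 * (\<integral>v. G v \<partial>\<mu>))"
  proof -
    have "0 \<le> (\<integral>v. F v \<partial>\<mu>)"
      using h1(1) by (intro Bochner_Integration.integral_nonneg) (auto simp: F_def)
    moreover have "0 \<le> (\<integral>v. G v \<partial>\<mu>)"
      using G_nonneg by (intro Bochner_Integration.integral_nonneg) auto
    ultimately show ?thesis
      using E_le J_ge b by (intro diff_mono mult_left_mono mult_right_mono) auto
  qed
  also have "\<dots> = (\<integral>v. 8 * b * M * F v - 3 / 8 * G v \<partial>\<mu>)"
    using F_int G_int by simp
  also have "\<dots> \<le> (\<integral>v. exp 1 * (256 * M) powr (1 + \<gamma> / 2)
      + k * b * (exp (1 + b * (32 * k) powr (2 / \<gamma>)) * E v - E v * logistic \<epsilon> (b * E v)) \<partial>\<mu>)"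
    (is "_ \<le> (\<integral>v. ?V v \<partial>\<mu>)")
  proof (rule integral_mono)
    have "integrable \<mu> (\<lambda>v. E v * logistic \<epsilon> (b * E v))"
      unfolding E_def by (rule tame_integrable[OF tame_mult_logistic[OF \<epsilon>(1) b(1) b1 \<epsilon>(2)]])
    then show "integrable \<mu> ?V"
      using E_int by simp
    show "8 * b * M * F v - 3 / 8 * G v \<le> ?V v" for v
      using collision_pointwise[OF \<epsilon>(1) \<gamma>(1) \<epsilon>(2) M(1) b k, of "v \<bullet> v"]
      by (simp add: F_def G_def E_def h1_def[abs_def])
  qed (use F_int G_int in simp)
  also have "\<dots> = exp 1 * (256 * M) powr (1 + \<gamma> / 2)
      + k * b * (exp (1 + b * (32 * k) powr (2 / \<gamma>)) * (\<integral>v. E v \<partial>\<mu>) - (\<integral>v. E v * logistic \<epsilon> (b * E v) \<partial>\<mu>))"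
  proof -
    have "integrable \<mu> (\<lambda>v. E v * logistic \<epsilon> (b * E v))"
      unfolding E_def by (rule tame_integrable[OF tame_mult_logistic[OF \<epsilon>(1) b(1) b1 \<epsilon>(2)]])
    then show ?thesis
      using E_int by (simp add: prob_space)
  qed
  also have "\<dots> \<le> exp 1 * (256 * M) powr (1 + \<gamma> / 2)
      + k * b * (exp (1 + b * (32 * k) powr (2 / \<gamma>)) * M - (\<integral>v. E v * logistic \<epsilon> (b * E v) \<partial>\<mu>))"
    using E_le k b by (intro add_left_mono mult_left_mono diff_right_mono) auto
  finally show ?thesis
    by (simp add: h_def[abs_def] E_def)
qed

end

section \<open>Propagation in time\<close>

text \<open>With slack e (u - s), the times at which F has not exceeded its allowance form a compact
  set. Its last point is t, since otherwise the right increment bound would extend it. Then e tends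
  to 0.\<close>

lemma le_if_right_dini_nonpos:
  fixes F :: "real \<Rightarrow> real"
  assumes st: "s \<le> t" and cont: "continuous_on {s..t} F"
    and dini: "\<And>u e. s \<le> u \<Longrightarrow> u < t \<Longrightarrow> 0 < e \<Longrightarrow> \<forall>\<^sub>F r in at_right u. F r \<le> F u + e * (r - u)"
  shows "F t \<le> F s"
proof -
  have *: "F t \<le> F s + e * (t - s)" if e: "0 < e" for e
  proof -
    define S where "S = {s..t} \<inter> (\<lambda>u. F u - e * (u - s)) -` {..F s}"
    have "closed S"
      unfolding S_def by (intro continuous_closed_preimage continuous_intros cont)
    then have "compact S"
      using compact_Int_closed[of "{s..t}" S] by (simp add: S_def Int_absorb1 flip: Int_assoc)
    moreover have "s \<in> S"
      using st by (simp add: S_def)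
    ultimately obtain c where c: "c \<in> S" "\<And>r. r \<in> S \<Longrightarrow> r \<le> c"
      using compact_attains_sup[of S] by blast
    have "c = t"
    proof (rule ccontr)
      assume "c \<noteq> t"
      then have ct: "s \<le> c" "c < t"
        using c by (auto simp: S_def)
      have "\<forall>\<^sub>F r in at_right c. F r \<le> F c + e * (r - c) \<and> r \<in> {c<..<t}"
        using dini[OF ct e] eventually_at_right_real[OF ct(2)] by eventually_elim auto
      then obtain r where r: "F r \<le> F c + e * (r - c)" "c < r" "r < t"
        using eventually_happens[of _ "at_right c"] by (auto simp: trivial_limit_at_right_real)
      moreover have "F c - e * (c - s) \<le> F s"
        using c by (auto simp: S_def)
      ultimately have "r \<in> S"
        using ct by (auto simp: S_def algebra_simps)
      then show False
        using c r by force
    qed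
    then show ?thesis
      using c by (auto simp: S_def algebra_simps)
  qed
  show ?thesis
  proof (rule field_le_epsilon)
    fix d :: real assume d: "0 < d"
    \<comment> \<open>The added 1 in the denominator covers the case s = t.\<close>
    have "F t \<le> F s + d / (t - s + 1) * (t - s)"
      using d st by (intro *) auto
    also have "d / (t - s + 1) * (t - s) \<le> d"
      using d st by (simp add: divide_simps)
    finally show "F t \<le> F s + d"
      by simp
  qed
qed

section \<open>Evolution of the regularised exponential moments\<close>

context landau_solution
begin

text \<open>An upper bound for the energy at all times, despite its name; the added 1 makes it at
  least 1 even when the energy vanishes.\<close>

definition mass :: real where
  "mass = enn2real (moment 2 (f 0)) + 1"

lemma mass_ge_1: "1 \<le> mass"
  by (simp add: mass_def)

lemma energy_le_mass: "0 \<le> t \<Longrightarrow> (\<integral>v. v \<bullet> v \<partial>f t) \<le> mass"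
  using energy_le[of t] by (simp add: mass_def)

lemma tame_integrable_f:
  assumes "tame C h h1 h2" "0 \<le> t"
  shows "integrable (f t) (radial h)"
proof (rule Bochner_Integration.integrable_bound[OF integrable_mult_right[OF integrable_one_energy[OF assms(2)], of C]])
  show "radial h \<in> borel_measurable (f t)"
    unfolding measurable_f[OF assms(2)] using assms C2_radial_measurable(1) by (auto simp: tame_def)
  show "AE v in f t. norm (radial h v) \<le> norm (C * (1 + v \<bullet> v))"
    using assms(1) by (intro AE_I2) (auto simp: tame_def intro: order_trans[OF _ abs_ge_self])
qed

lemma tame_continuous:
  assumes "tame C h h1 h2"
  shows "continuous_on {0..T} (\<lambda>t. \<integral>v. h (v \<bullet> v) \<partial>f t)"
proof (cases "0 \<le> T")
  case True
  have "continuous_on {0..T} (\<lambda>t. (\<integral>v. h (v \<bullet> v) \<partial>f 0) + integral {0..t} (dissipation h))"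
    using dissipation_integrable[OF assms True]
    by (intro continuous_intros indefinite_integral_continuous_1 set_borel_integral_eq_integral)
  then show ?thesis
  proof (rule continuous_on_eq)
    fix t assume "t \<in> {0..T}"
    then show "(\<integral>v. h (v \<bullet> v) \<partial>f 0) + integral {0..t} (dissipation h) = (\<integral>v. h (v \<bullet> v) \<partial>f t)"
      using tame_weak[OF assms, of t] dissipation_integrable[OF assms, of t]
      by (simp add: set_borel_integral_eq_integral)
  qed
qed simp

text \<open>The fixed-time estimates require a finite \<open>total_weight\<close>, so the bound c is
  asked for only at such times, which are almost all.\<close>

lemma tame_increment_le:
  assumes h: "tame C h h1 h2" and ur: "0 \<le> u" "u \<le> r"
    and c: "\<And>s. u \<le> s \<Longrightarrow> s \<le> r \<Longrightarrow> total_weight s < \<infinity> \<Longrightarrow> landau_weak_rhs \<gamma> (radial h) (f s) \<le> c"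
  shows "(\<integral>v. h (v \<bullet> v) \<partial>f r) - (\<integral>v. h (v \<bullet> v) \<partial>f u) \<le> c * (r - u)"
proof -
  have i: "set_integrable lborel {0..u} (dissipation h)" "set_integrable lborel {0..r} (dissipation h)"
    using ur by (auto intro: dissipation_integrable[OF h])
  have j: "set_integrable lborel {u<..r} (dissipation h)"
    by (rule set_integrable_subset[OF i(2)]) (use ur in auto)
  have "(LINT s:{0..u} \<union> {u<..r}|lborel. dissipation h s)
      = (LINT s:{0..u}|lborel. dissipation h s) + (LINT s:{u<..r}|lborel. dissipation h s)"
    by (rule set_integral_Un[OF _ i(1) j]) auto
  moreover have "{0..u} \<union> {u<..r} = {0..r}"
    using ur by auto
  ultimately have "(\<integral>v. h (v \<bullet> v) \<partial>f r) - (\<integral>v. h (v \<bullet> v) \<partial>f u) = (LINT s:{u<..r}|lborel. dissipation h s)"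
    using tame_weak[OF h, of u] tame_weak[OF h, of r] ur by simp
  also have "\<dots> \<le> (LINT s:{u<..r}|lborel. c)"
    unfolding set_lebesgue_integral_def
  proof (rule integral_mono_AE)
    show "integrable lborel (\<lambda>s. indicator {u<..r} s *\<^sub>R dissipation h s)"
      using j by (simp add: set_integrable_def)
    show "integrable lborel (\<lambda>s. indicator {u<..r} s *\<^sub>R c)"
      using ur by simp
    show "AE s in lborel. indicator {u<..r} s *\<^sub>R dissipation h s \<le> indicator {u<..r} s *\<^sub>R c"
      using AE_total_weight_finite[of r]
    proof eventually_elim
      case (elim s)
      then show ?case
        using c[of s] ur by (auto simp: dissipation_def indicator_def)
    qed
  qed
  also have "\<dots> = c * (r - u)"
    using ur by (simp add: set_lebesgue_integral_def)
  finally show ?thesis .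
qed

context
  fixes \<epsilon> :: real
  assumes \<epsilon>: "0 < \<epsilon>" "\<epsilon> \<le> 1"
begin

definition soft_moment :: "real \<Rightarrow> real \<Rightarrow> real" where
  "soft_moment b s = (\<integral>v. soft_exp \<epsilon> (b * (v \<bullet> v)) \<partial>f s)"

definition logistic_moment :: "real \<Rightarrow> real \<Rightarrow> real" where
  "logistic_moment b s = (\<integral>v. (v \<bullet> v) * logistic \<epsilon> (b * (v \<bullet> v)) \<partial>f s)"

lemma soft_integrable:
  assumes "0 < b" "b \<le> 1" "0 \<le> s"
  shows "integrable (f s) (\<lambda>v. soft_exp \<epsilon> (b * (v \<bullet> v)))"
    "integrable (f s) (\<lambda>v. (v \<bullet> v) * logistic \<epsilon> (b * (v \<bullet> v)))"
  using tame_integrable_f[OF tame_soft_exp[OF \<epsilon>(1) assms(1,2) \<epsilon>(2)] assms(3)]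
    tame_integrable_f[OF tame_mult_logistic[OF \<epsilon>(1) assms(1,2) \<epsilon>(2)] assms(3)] by auto

text \<open>The first bound is an expansion to first order with the derivative taken at the smaller
  rate b, the rate at which the collision bound is used; its error is quadratic because z^2 exp (-
  z) <= 2. The second is Lipschitz in the rate uniformly in time and serves continuity.\<close>

lemma soft_moment_parameter:
  assumes b: "0 < b" "b \<le> b'" "b' \<le> 1" and s: "0 \<le> s"
  shows "soft_moment b' s - soft_moment b s
      \<le> (b' - b) * (logistic_moment b s + 2 / (b\<^sup>2 * \<epsilon>\<^sup>2) * (b' - b))" (is "_ \<le> ?A")
    and "\<bar>soft_moment b' s - soft_moment b s\<bar> \<le> (b' - b) * (mass / \<epsilon>)"
proof -
  interpret prob_space "f s"
    by (rule prob_space_f[OF s])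
  have b': "0 < b'" "b \<le> 1"
    using b by auto
  note i = soft_integrable[OF b(1) b'(2) s] soft_integrable[OF b'(1) b(3) s]
  have pt: "soft_exp \<epsilon> (b' * x) - soft_exp \<epsilon> (b * x) \<le> (b' - b) * (x * logistic \<epsilon> (b' * x))"
    "0 \<le> soft_exp \<epsilon> (b' * x) - soft_exp \<epsilon> (b * x)" if "0 \<le> x" for x
    using soft_exp_convex[OF \<epsilon>(1), of "b * x" "b' * x"] that b
    by (auto simp: mult_right_mono left_diff_distrib)
  have lip: "x * logistic \<epsilon> (b' * x) \<le> x * logistic \<epsilon> (b * x) + 2 / (b\<^sup>2 * \<epsilon>\<^sup>2) * (b' - b)" if x: "0 \<le> x" for x
  proof -
    define z where "z = b * x"
    have z: "0 \<le> z"
      using b x by (simp add: z_def)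
    have "x * (logistic \<epsilon> (b' * x) - logistic \<epsilon> (b * x)) \<le> x * (exp (- (b * x)) * (b' * x - b * x) / \<epsilon> ^ 2)"
      using b x by (intro mult_left_mono logistic_lipschitz[OF \<epsilon>(1)]) (auto intro: mult_right_mono)
    also have "\<dots> = (z * (z * exp (- z))) * ((b' - b) / (b\<^sup>2 * \<epsilon>\<^sup>2))"
      using b \<epsilon> by (simp add: z_def power2_eq_square divide_simps) (simp add: algebra_simps)
    also have "\<dots> \<le> 2 * ((b' - b) / (b\<^sup>2 * \<epsilon>\<^sup>2))"
      using b square_mult_exp_minus_le_2[OF z] by (intro mult_right_mono) auto
    finally show ?thesis
      by (simp add: algebra_simps)
  qed
  have eq: "soft_moment b' s - soft_moment b s = (\<integral>v. soft_exp \<epsilon> (b' * (v \<bullet> v)) - soft_exp \<epsilon> (b * (v \<bullet> v)) \<partial>f s)"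
    using i by (simp add: soft_moment_def)
  also have "\<dots> \<le> (\<integral>v. (b' - b) * ((v \<bullet> v) * logistic \<epsilon> (b * (v \<bullet> v)) + 2 / (b\<^sup>2 * \<epsilon>\<^sup>2) * (b' - b)) \<partial>f s)"
  proof (rule integral_mono)
    show "soft_exp \<epsilon> (b' * (v \<bullet> v)) - soft_exp \<epsilon> (b * (v \<bullet> v))
        \<le> (b' - b) * ((v \<bullet> v) * logistic \<epsilon> (b * (v \<bullet> v)) + 2 / (b\<^sup>2 * \<epsilon>\<^sup>2) * (b' - b))" for v
      by (rule order_trans[OF pt(1) mult_left_mono[OF lip]]) (use b in auto)
  qed (use i in auto)
  also have "\<dots> = ?A"
    using i by (simp add: logistic_moment_def prob_space)
  finally show "soft_moment b' s - soft_moment b s \<le> ?A" .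
  have "0 \<le> soft_moment b' s - soft_moment b s"
    unfolding eq using pt(2) by (intro Bochner_Integration.integral_nonneg) auto
  moreover have "soft_moment b' s - soft_moment b s \<le> (\<integral>v. (b' - b) * ((v \<bullet> v) * (1 / \<epsilon>)) \<partial>f s)"
    unfolding eq
  proof (rule integral_mono)
    show "soft_exp \<epsilon> (b' * (v \<bullet> v)) - soft_exp \<epsilon> (b * (v \<bullet> v)) \<le> (b' - b) * ((v \<bullet> v) * (1 / \<epsilon>))" for v
      by (rule order_trans[OF pt(1)]) (use b in \<open>auto intro!: mult_left_mono logistic_le[OF \<epsilon>(1)] simp del: times_divide_eq_right\<close>)
  qed (use i integrable_energy[OF s] in auto)
  moreover have "(\<integral>v. (b' - b) * ((v \<bullet> v) * (1 / \<epsilon>)) \<partial>f s) = (b' - b) * ((\<integral>v. v \<bullet> v \<partial>f s) / \<epsilon>)"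
    by simp
  moreover have "(b' - b) * ((\<integral>v. v \<bullet> v \<partial>f s) / \<epsilon>) \<le> (b' - b) * (mass / \<epsilon>)"
    using b \<epsilon> energy_le_mass[OF s] by (intro mult_left_mono divide_right_mono) auto
  ultimately show "\<bar>soft_moment b' s - soft_moment b s\<bar> \<le> (b' - b) * (mass / \<epsilon>)"
    by linarith
qed

text \<open>For fixed \<epsilon> the bound tends to 1 with b. This is the initial value of the
  propagation, obtained from the energy alone.\<close>

lemma soft_moment_le:
  assumes b: "0 < b" "b \<le> 1" and s: "0 \<le> s"
  shows "soft_moment b s \<le> 1 + b * (mass / \<epsilon>)"
proof -
  interpret prob_space "f s"
    by (rule prob_space_f[OF s])
  have "soft_moment b s \<le> (\<integral>v. 1 + b * (v \<bullet> v) * (1 / \<epsilon>) \<partial>f s)"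
    unfolding soft_moment_def
  proof (rule integral_mono)
    fix v
    define z where "z = b * (v \<bullet> v)"
    have z: "0 \<le> z"
      using b by (simp add: z_def)
    have "soft_exp \<epsilon> z \<le> 1 + z * (1 / \<epsilon>)"
      using soft_exp_convex(1)[OF \<epsilon>(1) z] soft_exp_0_le_1[OF \<epsilon>(1)] mult_left_mono[OF logistic_le[OF \<epsilon>(1)] z, of z] by simp
    then show "soft_exp \<epsilon> (b * (v \<bullet> v)) \<le> 1 + b * (v \<bullet> v) * (1 / \<epsilon>)"
      by (simp add: z_def)
  qed (use soft_integrable[OF b s] integrable_energy[OF s] in auto)
  also have "\<dots> = 1 + b * ((\<integral>v. v \<bullet> v \<partial>f s) / \<epsilon>)"
    using integrable_energy[OF s] by (simp add: prob_space)
  also have "\<dots> \<le> 1 + b * (mass / \<epsilon>)"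
    using b \<epsilon> energy_le_mass[OF s] by (intro add_left_mono mult_left_mono divide_right_mono) auto
  finally show ?thesis .
qed

lemma logistic_moment_continuous:
  assumes "0 < b" "b \<le> 1"
  shows "continuous_on {0..T} (logistic_moment b)"
  using tame_continuous[OF tame_mult_logistic[OF \<epsilon>(1) assms \<epsilon>(2)], of T]
  by (simp add: logistic_moment_def[abs_def])

lemma soft_moment_continuous:
  assumes "0 < b" "b \<le> 1"
  shows "continuous_on {0..T} (soft_moment b)"
  using tame_continuous[OF tame_soft_exp[OF \<epsilon>(1) assms \<epsilon>(2)], of T]
  by (simp add: soft_moment_def[abs_def])

text \<open>A frozen rate makes the weak equation applicable. The number l allows
  \<open>logistic_moment\<close> to be replaced by its value at the left endpoint up to a small
  margin.\<close>

lemma soft_moment_increment: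
  assumes b: "0 < b" "b * (256 * mass) \<le> 1" and k: "0 < k" and ur: "0 \<le> u" "u \<le> r"
    and l: "\<And>s. u \<le> s \<Longrightarrow> s \<le> r \<Longrightarrow> l \<le> logistic_moment b s"
  shows "soft_moment b r - soft_moment b u \<le> (exp 1 * (256 * mass) powr (1 + \<gamma> / 2)
      + k * b * (exp (1 + b * (32 * k) powr (2 / \<gamma>)) * mass - l)) * (r - u)"
proof -
  have "b \<le> b * (256 * mass)"
    using b mass_ge_1 by simp
  then have b1: "b \<le> 1"
    using b by linarith
  show ?thesis
    unfolding soft_moment_def
  proof (rule tame_increment_le[OF tame_soft_exp[OF \<epsilon>(1) b(1) b1 \<epsilon>(2)] ur])
    fix s assume s: "u \<le> s" "s \<le> r" "total_weight s < \<infinity>"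
    then have s0: "0 \<le> s"
      using ur by simp
    interpret weighted_prob "f s" \<gamma>
      by (rule weighted_prob_f[OF s0 s(3)])
    have "landau_weak_rhs \<gamma> (radial (\<lambda>r. soft_exp \<epsilon> (b * r))) (f s) \<le> exp 1 * (256 * mass) powr (1 + \<gamma> / 2)
      + k * b * (exp (1 + b * (32 * k) powr (2 / \<gamma>)) * mass - logistic_moment b s)"
      unfolding logistic_moment_def
      by (rule landau_weak_rhs_soft_exp_le[OF \<epsilon> mass_ge_1 energy_le_mass[OF s0] b k])
    also have "\<dots> \<le> exp 1 * (256 * mass) powr (1 + \<gamma> / 2)
      + k * b * (exp (1 + b * (32 * k) powr (2 / \<gamma>)) * mass - l)"
      using k b l[OF s(1,2)] by (intro add_left_mono mult_left_mono diff_left_mono) auto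
    finally show "landau_weak_rhs \<gamma> (radial (\<lambda>r. soft_exp \<epsilon> (b * r))) (f s) \<le> exp 1 * (256 * mass) powr (1 + \<gamma> / 2)
      + k * b * (exp (1 + b * (32 * k) powr (2 / \<gamma>)) * mass - l)" .
  qed
qed

text \<open>
  Along \<open>\<alpha> r = a * ((r - t0) / \<tau>) powr (2 / \<gamma>)\<close> the growth of the weight contributes
  \<open>\<alpha>' * logistic_moment\<close>, which the collision term absorbs with \<open>k = \<alpha>' / \<alpha>\<close>; for this
  exponent \<open>\<alpha> * k powr (2 / \<gamma>)\<close> does not depend on \<open>r\<close>.
\<close>

lemma soft_moment_dini:
  assumes t0: "0 \<le> t0" "t0 < u" and \<tau>: "0 < \<tau>" and a: "0 < a" "a * (256 * mass) \<le> 1"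
    and ut: "u < t0 + \<tau>" and e: "0 < e"
  defines "\<alpha> \<equiv> \<lambda>r. a * ((r - t0) / \<tau>) powr (2 / \<gamma>)"
    and "B \<equiv> exp (1 + a * (64 / (\<gamma> * \<tau>)) powr (2 / \<gamma>)) * mass"
    and "C1 \<equiv> exp 1 * (256 * mass) powr (1 + \<gamma> / 2)"
  defines "F \<equiv> \<lambda>r. soft_moment (\<alpha> r) r - B * \<alpha> r - C1 * r"
  shows "\<forall>\<^sub>F r in at_right u. F r \<le> F u + e * (r - u)"
proof -
  define b where "b = \<alpha> u"
  \<comment> \<open>This is the logarithmic derivative of \<open>\<alpha>\<close> at u, so that
    \<open>\<kappa>\<close> below is its derivative there.\<close>
  define k where "k = 2 / \<gamma> / (u - t0)"
  define \<kappa> where "\<kappa> = k * b"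
  have k: "0 < k"
    using \<gamma> t0 by (simp add: k_def)
  have b: "0 < b"
    using a t0 \<tau> by (simp add: b_def \<alpha>_def)
  have \<kappa>: "0 < \<kappa>"
    using k b by (simp add: \<kappa>_def)
  have \<alpha>_le: "\<alpha> r \<le> a" if "t0 \<le> r" "r \<le> t0 + \<tau>" for r
  proof -
    have "((r - t0) / \<tau>) powr (2 / \<gamma>) \<le> 1 powr (2 / \<gamma>)"
      using that \<tau> \<gamma> by (intro powr_mono2) auto
    then show ?thesis
      using a by (simp add: \<alpha>_def)
  qed
  have \<alpha>_mono: "b \<le> \<alpha> r" if "u \<le> r" for r
    unfolding b_def \<alpha>_def using that a \<tau> t0 \<gamma> by (intro mult_left_mono powr_mono2 divide_right_mono) auto
  have ba: "b \<le> a"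
    unfolding b_def using t0 ut by (intro \<alpha>_le) auto
  have M: "1 \<le> mass"
    by (rule mass_ge_1)
  have "a \<le> a * (256 * mass)"
    using a M by simp
  then have a1: "a \<le> 1"
    using a by linarith
  have "b * (256 * mass) \<le> a * (256 * mass)"
    using ba M by (intro mult_right_mono) auto
  then have bM: "b * (256 * mass) \<le> 1"
    using a by linarith
  have b1: "b \<le> 1"
    using ba a1 by linarith
  have B: "exp (1 + b * (32 * k) powr (2 / \<gamma>)) * mass = B"
  proof -
    have "((u - t0) / \<tau>) powr (2 / \<gamma>) * (32 * k) powr (2 / \<gamma>) = (((u - t0) / \<tau>) * (32 * k)) powr (2 / \<gamma>)"
      by (rule powr_mult[symmetric])
    also have "((u - t0) / \<tau>) * (32 * k) = 64 / (\<gamma> * \<tau>)"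
      using t0 \<gamma> \<tau> by (simp add: k_def divide_simps)
    finally show ?thesis
      by (simp add: B_def b_def \<alpha>_def mult.assoc)
  qed
  define \<Gamma> where "\<Gamma> = logistic_moment b u"
  \<comment> \<open>A margin for the continuity of \<open>logistic_moment b\<close>, small enough
    that \<open>\<kappa> * \<eta>\<close> stays below e.\<close>
  define \<eta> where "\<eta> = e / (\<kappa> + 1)"
  have \<eta>: "0 < \<eta>" "\<kappa> * \<eta> < e"
    using e \<kappa> by (auto simp: \<eta>_def divide_simps)
  have "(logistic_moment b \<longlongrightarrow> logistic_moment b u) (at u within {0..u + 1})"
    using logistic_moment_continuous[OF b b1, of "u + 1"] t0 by (auto simp: continuous_on_def)
  then have "(logistic_moment b \<longlongrightarrow> \<Gamma>) (at u within {u..u + 1})"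
    unfolding \<Gamma>_def by (rule tendsto_within_subset) (use t0 in auto)
  then have lim_\<Gamma>: "(logistic_moment b \<longlongrightarrow> \<Gamma>) (at_right u)"
    by (simp add: at_within_Icc_at_right)
  have d\<alpha>: "(\<alpha> has_real_derivative \<kappa>) (at u)"
  proof -
    have "(\<alpha> has_real_derivative a * (2 / \<gamma> * ((u - t0) / \<tau>) powr (2 / \<gamma> - of_nat 1) * (1 / \<tau>))) (at u)"
      unfolding \<alpha>_def using t0 \<tau>
      by (intro DERIV_cmult DERIV_fun_powr) (auto intro!: derivative_eq_intros)
    moreover have "a * (2 / \<gamma> * ((u - t0) / \<tau>) powr (2 / \<gamma> - of_nat 1) * (1 / \<tau>)) = \<kappa>"
      using t0 \<tau> by (simp add: \<kappa>_def k_def b_def \<alpha>_def powr_diff)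
    ultimately show ?thesis by simp
  qed
  define q where "q r = (\<alpha> r - b) / (r - u)" for r
  have lim_q: "(q \<longlongrightarrow> \<kappa>) (at_right u)"
    using d\<alpha> unfolding has_field_derivative_iff q_def[abs_def] b_def
    by (rule tendsto_within_subset) simp
  have lim_\<alpha>: "(\<alpha> \<longlongrightarrow> b) (at_right u)"
    using DERIV_isCont[OF d\<alpha>] unfolding b_def isCont_def
    by (rule tendsto_within_subset) simp
  define K where "K = 2 / (b\<^sup>2 * \<epsilon>\<^sup>2)"
  \<comment> \<open>The growth of the rate and the collision term contribute opposite multiples of
    \<open>\<Gamma>\<close> and of \<open>B\<close>; in the limit everything cancels except
    \<open>\<kappa> * \<eta>\<close>.\<close>
  have "((\<lambda>r. q r * (logistic_moment b r + K * (\<alpha> r - b) - B) + \<kappa> * (B - \<Gamma> + \<eta>))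
      \<longlongrightarrow> \<kappa> * (\<Gamma> + K * (b - b) - B) + \<kappa> * (B - \<Gamma> + \<eta>)) (at_right u)"
    by (intro tendsto_intros lim_q lim_\<Gamma> lim_\<alpha>)
  then have "\<forall>\<^sub>F r in at_right u. q r * (logistic_moment b r + K * (\<alpha> r - b) - B) + \<kappa> * (B - \<Gamma> + \<eta>) < e"
    using \<eta> by (intro order_tendstoD(2)) (auto simp: algebra_simps)
  moreover have "\<forall>\<^sub>F r in at_right u. \<forall>s. u \<le> s \<longrightarrow> s \<le> r \<longrightarrow> \<Gamma> - \<eta> \<le> logistic_moment b s"
  proof -
    have "\<forall>\<^sub>F s in at_right u. \<Gamma> - \<eta> < logistic_moment b s"
      using \<eta> by (intro order_tendstoD(1)[OF lim_\<Gamma>]) auto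
    then obtain c where c: "u < c" "\<And>s. u < s \<Longrightarrow> s < c \<Longrightarrow> \<Gamma> - \<eta> < logistic_moment b s"
      by (auto simp: eventually_at_right_field)
    have "\<forall>\<^sub>F r in at_right u. r \<in> {u<..<c}"
      by (rule eventually_at_right_real[OF c(1)])
    then show ?thesis
    proof eventually_elim
      case (elim r)
      show ?case
      proof (intro allI impI)
        fix s assume "u \<le> s" "s \<le> r"
        then show "\<Gamma> - \<eta> \<le> logistic_moment b s"
          using c(2)[of s] elim \<eta> by (cases "s = u") (auto simp: \<Gamma>_def)
      qed
    qed
  qed
  moreover have "\<forall>\<^sub>F r in at_right u. r \<in> {u<..<t0 + \<tau>}"
    by (rule eventually_at_right_real[OF ut])
  ultimately show ?thesis
  proof eventually_elim
    case (elim r)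
    then have r: "u < r" "r < t0 + \<tau>"
      by auto
    have \<alpha>r: "b \<le> \<alpha> r" "\<alpha> r \<le> 1"
      using \<alpha>_mono[of r] \<alpha>_le[of r] r t0 a1 by auto
    have "soft_moment (\<alpha> r) r - soft_moment b r \<le> (\<alpha> r - b) * (logistic_moment b r + K * (\<alpha> r - b))"
      unfolding K_def using r t0 by (intro soft_moment_parameter(1)[OF b \<alpha>r]) auto
    moreover have "soft_moment b r - soft_moment b u \<le> (C1 + k * b * (B - (\<Gamma> - \<eta>))) * (r - u)"
      unfolding C1_def B[symmetric] using r t0 elim(2) by (intro soft_moment_increment[OF b bM k]) auto
    ultimately have "F r - F u \<le> (\<alpha> r - b) * (logistic_moment b r + K * (\<alpha> r - b))
        + (C1 + k * b * (B - (\<Gamma> - \<eta>))) * (r - u) - B * (\<alpha> r - b) - C1 * (r - u)"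
      unfolding F_def b_def[symmetric] by (simp add: algebra_simps)
    also have "\<dots> = (\<alpha> r - b) * (logistic_moment b r + K * (\<alpha> r - b) - B) + \<kappa> * (B - \<Gamma> + \<eta>) * (r - u)"
      by (simp add: \<kappa>_def algebra_simps)
    also have "\<alpha> r - b = q r * (r - u)"
      using r by (simp add: q_def)
    also have "q r * (r - u) * (logistic_moment b r + K * (q r * (r - u)) - B) + \<kappa> * (B - \<Gamma> + \<eta>) * (r - u)
        = (q r * (logistic_moment b r + K * (q r * (r - u)) - B) + \<kappa> * (B - \<Gamma> + \<eta>)) * (r - u)"
      by (simp add: algebra_simps)
    also have "\<dots> \<le> e * (r - u)"
    proof (rule mult_right_mono)
      have "q r * (r - u) = \<alpha> r - b"
        using r by (simp add: q_def)
      then show "q r * (logistic_moment b r + K * (q r * (r - u)) - B) + \<kappa> * (B - \<Gamma> + \<eta>) \<le> e"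
        using elim(1) by simp
    qed (use r in simp)
    finally show ?case
      by simp
  qed
qed

end

end

section \<open>From rate zero to the Gaussian moment\<close>

context landau_solution
begin

text \<open>F is nonincreasing while the rate grows from 0 to a over a time \<tau>. The start t0
  itself is excluded, as the logarithmic derivative of the rate is infinite there; the propagation
  begins at rate a y and y tends to 0 with \<epsilon> fixed.\<close>

lemma soft_moment_bound:
  assumes \<epsilon>: "0 < \<epsilon>" "\<epsilon> \<le> 1" and \<tau>: "0 < \<tau>" "\<tau> \<le> t" "\<tau> \<le> 1"
    and a: "0 < a" "a * (256 * mass) \<le> 1"
  shows "soft_moment \<epsilon> a t \<le> 1 + exp (1 + a * (64 / (\<gamma> * \<tau>)) powr (2 / \<gamma>)) * mass * a
    + exp 1 * (256 * mass) powr (1 + \<gamma> / 2)"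
proof -
  define t0 where "t0 = t - \<tau>"
  define \<alpha> where "\<alpha> r = a * ((r - t0) / \<tau>) powr (2 / \<gamma>)" for r
  define B where "B = exp (1 + a * (64 / (\<gamma> * \<tau>)) powr (2 / \<gamma>)) * mass"
  define C1 where "C1 = exp 1 * (256 * mass) powr (1 + \<gamma> / 2)"
  define F where "F r = soft_moment \<epsilon> (\<alpha> r) r - B * \<alpha> r - C1 * r" for r
  have t0: "0 \<le> t0" "t = t0 + \<tau>"
    using \<tau> by (auto simp: t0_def)
  have B: "0 \<le> B" and C1: "0 \<le> C1"
    using mass_ge_1 by (auto simp: B_def C1_def)
  have "a \<le> a * (256 * mass)"
    using a mass_ge_1 by simp
  then have a1: "a \<le> 1"
    using a by linarith
  have \<alpha>_pos: "0 < \<alpha> r" if "t0 < r" for r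
    using that a \<tau> by (simp add: \<alpha>_def)
  have \<alpha>_mono: "\<alpha> r \<le> \<alpha> r'" if "t0 \<le> r" "r \<le> r'" for r r'
    unfolding \<alpha>_def using that a \<tau> \<gamma> by (intro mult_left_mono powr_mono2 divide_right_mono) auto
  have \<alpha>_t: "\<alpha> t = a"
    using \<tau> by (simp add: \<alpha>_def t0_def)
  have \<alpha>_le: "\<alpha> r \<le> 1" if "t0 \<le> r" "r \<le> t" for r
    using \<alpha>_mono[OF that] a1 by (simp add: \<alpha>_t)
  have bound: "soft_moment \<epsilon> a t \<le> 1 + a * y * (mass / \<epsilon>) + B * a + C1" if y: "0 < y" "y < 1" for y
  proof -
    \<comment> \<open>The time at which the rate has the value a y.\<close>
    define t1 where "t1 = t0 + \<tau> * y powr (\<gamma> / 2)"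
    have y': "0 < y powr (\<gamma> / 2)" "y powr (\<gamma> / 2) \<le> 1"
      using y \<gamma> powr_mono2[of "\<gamma> / 2" y 1] by auto
    have t1: "t0 < t1" "t1 \<le> t"
      using y' \<tau> t0 by (auto simp: t1_def mult_left_le)
    have \<alpha>1: "\<alpha> t1 = a * y"
      using y \<gamma> \<tau> by (simp add: \<alpha>_def t1_def powr_powr)
    have "F t \<le> F t1"
    proof (rule le_if_right_dini_nonpos[OF t1(2)])
      show "\<forall>\<^sub>F r in at_right u. F r \<le> F u + e * (r - u)" if "t1 \<le> u" "u < t" "0 < e" for u e
        unfolding F_def \<alpha>_def B_def C1_def
        by (rule soft_moment_dini[OF \<epsilon> t0(1) _ \<tau>(1) a _ that(3)]) (use that t1 t0 in auto)
      have c\<alpha>: "continuous_on {t1..t} \<alpha>"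
        unfolding \<alpha>_def[abs_def] using t1 \<tau> by (intro continuous_intros) auto
      \<comment> \<open>Rate and time vary together: continuity in time at the fixed rate b is
        combined with the Lipschitz bound in the rate, which is uniform in time.\<close>
      have "continuous_on {t1..t} (\<lambda>r. soft_moment \<epsilon> (\<alpha> r) r)"
        unfolding continuous_on_def
      proof
        fix u assume u: "u \<in> {t1..t}"
        define b where "b = \<alpha> u"
        have b: "0 < b" "b \<le> 1"
          using u t1 \<alpha>_pos \<alpha>_le by (auto simp: b_def)
        have "(soft_moment \<epsilon> b \<longlongrightarrow> soft_moment \<epsilon> b u) (at u within {0..t})"
          using soft_moment_continuous[OF \<epsilon> b, of t] u t0 t1 by (auto simp: continuous_on_def)
        then have l1: "(soft_moment \<epsilon> b \<longlongrightarrow> soft_moment \<epsilon> b u) (at u within {t1..t})"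
          by (rule tendsto_within_subset) (use t0 t1 in auto)
        have "(\<alpha> \<longlongrightarrow> b) (at u within {t1..t})"
          using c\<alpha> u by (auto simp: continuous_on_def b_def)
        then have "((\<lambda>r. \<bar>\<alpha> r - b\<bar> * (mass / \<epsilon>)) \<longlongrightarrow> \<bar>b - b\<bar> * (mass / \<epsilon>)) (at u within {t1..t})"
          by (intro tendsto_intros)
        then have l2: "((\<lambda>r. \<bar>\<alpha> r - b\<bar> * (mass / \<epsilon>)) \<longlongrightarrow> 0) (at u within {t1..t})"
          by simp
        have "((\<lambda>r. soft_moment \<epsilon> (\<alpha> r) r - soft_moment \<epsilon> b r) \<longlongrightarrow> 0) (at u within {t1..t})"
        proof (rule Lim_null_comparison[OF _ l2])
          show "\<forall>\<^sub>F r in at u within {t1..t}. norm (soft_moment \<epsilon> (\<alpha> r) r - soft_moment \<epsilon> b r) \<le> \<bar>\<alpha> r - b\<bar> * (mass / \<epsilon>)"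
            unfolding eventually_at_filter
          proof (intro always_eventually allI impI)
            fix r assume r: "r \<in> {t1..t}"
            then have r': "0 \<le> r" "0 < \<alpha> r" "\<alpha> r \<le> 1"
              using t0 t1 \<alpha>_pos \<alpha>_le by auto
            show "norm (soft_moment \<epsilon> (\<alpha> r) r - soft_moment \<epsilon> b r) \<le> \<bar>\<alpha> r - b\<bar> * (mass / \<epsilon>)"
            proof (cases "b \<le> \<alpha> r")
              case True
              then show ?thesis
                using soft_moment_parameter(2)[OF \<epsilon> b(1) True r'(3) r'(1)] by simp
            next
              case False
              then show ?thesis
                using soft_moment_parameter(2)[OF \<epsilon> r'(2) _ b(2) r'(1)] by (simp add: abs_minus_commute)
            qed
          qed
        qed
        from tendsto_add[OF this l1] show "((\<lambda>r. soft_moment \<epsilon> (\<alpha> r) r) \<longlongrightarrow> soft_moment \<epsilon> (\<alpha> u) u) (at u within {t1..t})"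
          by (simp add: b_def)
      qed
      then show "continuous_on {t1..t} F"
        unfolding F_def[abs_def] using c\<alpha> by (intro continuous_intros)
    qed
    moreover have "soft_moment \<epsilon> (\<alpha> t1) t1 \<le> 1 + \<alpha> t1 * (mass / \<epsilon>)"
      using t0 t1 by (intro soft_moment_le[OF \<epsilon>] \<alpha>_pos \<alpha>_le) auto
    ultimately have "soft_moment \<epsilon> a t \<le> 1 + a * y * (mass / \<epsilon>) + (B * a - B * (a * y)) + C1 * (t - t1)"
      by (simp add: F_def \<alpha>_t \<alpha>1 algebra_simps)
    moreover have "0 \<le> B * (a * y)"
      using B a y by simp
    \<comment> \<open>The elapsed time is at most \<tau> <= 1, so the constant source term
      contributes at most C1.\<close>
    moreover have "C1 * (t - t1) \<le> C1 * 1"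
      using C1 t1 t0 \<tau> by (intro mult_left_mono) auto
    ultimately show ?thesis
      by linarith
  qed
  have "((\<lambda>y. 1 + a * y * (mass / \<epsilon>) + B * a + C1) \<longlongrightarrow> 1 + a * 0 * (mass / \<epsilon>) + B * a + C1) (at_right 0)"
    by (intro tendsto_intros)
  moreover have "\<forall>\<^sub>F y in at_right (0::real). soft_moment \<epsilon> a t \<le> 1 + a * y * (mass / \<epsilon>) + B * a + C1"
    using eventually_at_right_real[OF zero_less_one] by eventually_elim (rule bound; simp)
  ultimately have "soft_moment \<epsilon> a t \<le> 1 + a * 0 * (mass / \<epsilon>) + B * a + C1"
    by (rule tendsto_lowerbound) simp
  then show ?thesis
    by (simp add: B_def C1_def)
qed

text \<open>The bound on the regularised moment is free of \<epsilon>, so Fatou's lemma along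
  \<epsilon> = 1 / (n + 1) removes the regularisation.\<close>

lemma exp_moment_bound:
  assumes \<tau>: "0 < \<tau>" "\<tau> \<le> t" "\<tau> \<le> 1" and a: "0 < a" "a * (256 * mass) \<le> 1"
  shows "(\<integral>\<^sup>+v. ennreal (exp (a * (norm v)\<^sup>2)) \<partial>f t) \<le>
    ennreal (1 + exp (1 + a * (64 / (\<gamma> * \<tau>)) powr (2 / \<gamma>)) * mass * a
      + exp 1 * (256 * mass) powr (1 + \<gamma> / 2))" (is "_ \<le> ennreal ?Z")
proof -
  define \<epsilon> where "\<epsilon> n = inverse (real (Suc n))" for n
  have \<epsilon>: "0 < \<epsilon> n" "\<epsilon> n \<le> 1" for n
    by (auto simp: \<epsilon>_def divide_simps)
  have t: "0 \<le> t"
    using \<tau> by simp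
  have "a \<le> a * (256 * mass)"
    using a mass_ge_1 by simp
  then have a1: "a \<le> 1"
    using a by linarith
  define g where "g n v = ennreal (soft_exp (\<epsilon> n) (a * (v \<bullet> v)))" for n and v :: "real^3"
  have g_meas: "g n \<in> borel_measurable (f t)" for n
    using soft_integrable(1)[OF \<epsilon> a(1) a1 t, of n] unfolding g_def[abs_def] by simp
  have g_lim: "(\<lambda>n. g n v) \<longlonglongrightarrow> ennreal (exp (a * (norm v)\<^sup>2))" for v
  proof -
    define c where "c = exp (a * (v \<bullet> v))"
    have "0 < c"
      by (simp add: c_def)
    then have "(\<lambda>n. ln (1 + inverse (real (Suc n)) * c) / inverse (real (Suc n))) \<longlonglongrightarrow> c"
      by real_asymp
    then show ?thesis
      unfolding g_def soft_exp_def \<epsilon>_def c_def power2_norm_eq_inner by (rule tendsto_ennrealI)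
  qed
  have "(\<integral>\<^sup>+v. ennreal (exp (a * (norm v)\<^sup>2)) \<partial>f t) = (\<integral>\<^sup>+v. liminf (\<lambda>n. g n v) \<partial>f t)"
    by (intro nn_integral_cong lim_imp_Liminf[symmetric] g_lim) simp
  also have "\<dots> \<le> liminf (\<lambda>n. \<integral>\<^sup>+v. g n v \<partial>f t)"
    by (rule nn_integral_liminf[OF g_meas])
  also have "\<dots> \<le> liminf (\<lambda>n. ennreal ?Z)"
  proof (intro Liminf_mono always_eventually allI)
    fix n
    have "(\<integral>\<^sup>+v. g n v \<partial>f t) = ennreal (soft_moment (\<epsilon> n) a t)"
      unfolding g_def soft_moment_def[OF \<epsilon>] using soft_integrable(1)[OF \<epsilon> a(1) a1 t, of n]
      by (intro nn_integral_eq_integral) (auto simp: soft_exp_nonneg[OF \<epsilon>(1)])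
    then show "(\<integral>\<^sup>+v. g n v \<partial>f t) \<le> ennreal ?Z"
      using soft_moment_bound[OF \<epsilon> \<tau> a, of n] by (simp add: ennreal_leI)
  qed
  also have "\<dots> = ennreal ?Z"
    by (simp add: Liminf_const)
  finally show ?thesis .
qed

end

text \<open>Choosing a and C before f expresses that they depend only on \<gamma> and on the energy
  m; the extended integral makes finiteness part of the claim.\<close>

theorem proposition6:
  fixes \<gamma> :: real and m :: ennreal
  assumes "0 < \<gamma>" and "\<gamma> \<le> 1"
  shows "\<exists>a>0. \<exists>C>0. \<forall>f. landau_weak_solution \<gamma> f \<longrightarrow> moment 2 (f 0) = m \<longrightarrow>
    (\<forall>t>0. (\<integral>\<^sup>+v. ennreal (exp (a * (norm v)\<^sup>2)) \<partial>f t)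
        \<le> ennreal (C * exp (C * t powr (- 2 / \<gamma>))))"
proof -
  define M where "M = enn2real m + 1"
  \<comment> \<open>The largest rate permitted by the smallness condition a * (256 M) <= 1 of the
    collision estimate.\<close>
  define a where "a = 1 / (256 * M)"
  define C1 where "C1 = exp 1 * (256 * M) powr (1 + \<gamma> / 2)"
  define \<beta> where "\<beta> = a * (64 / \<gamma>) powr (2 / \<gamma>)"
  \<comment> \<open>One constant serves as prefactor and as rate: the first summand dominates the
    prefactor, and \<beta> the coefficient of t^(-2/\<gamma>).\<close>
  define C where "C = (2 + C1) * exp (1 + \<beta>) + \<beta>"
  have M: "1 \<le> M"
    by (simp add: M_def)
  have a: "0 < a" "a * (256 * M) \<le> 1" "M * a \<le> 1"
    using M by (auto simp: a_def)
  have C1: "0 \<le> C1"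
    by (simp add: C1_def)
  have \<beta>: "0 \<le> \<beta>"
    using a by (simp add: \<beta>_def)
  have C: "0 < C" "\<beta> \<le> C" "(2 + C1) * exp (1 + \<beta>) \<le> C"
    using C1 \<beta> by (auto simp: C_def intro!: add_pos_nonneg mult_pos_pos add_nonneg_nonneg mult_nonneg_nonneg)
  have "(\<integral>\<^sup>+v. ennreal (exp (a * (norm v)\<^sup>2)) \<partial>f t) \<le> ennreal (C * exp (C * t powr (- 2 / \<gamma>)))"
    if f: "landau_weak_solution \<gamma> f" "moment 2 (f 0) = m" and t: "0 < t" for f t
  proof -
    interpret landau_solution \<gamma> f
      using assms f by unfold_locales
    have mass: "mass = M"
      by (simp add: mass_def M_def f)
    \<comment> \<open>For t > 1 only the last unit of time is used, so the bound does not grow with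
      t; this is why \<tau>^(-2/\<gamma>) is compared with 1 + T below.\<close>
    define \<tau> where "\<tau> = min 1 t"
    define T where "T = t powr (- 2 / \<gamma>)"
    define E where "E = exp (1 + a * (64 / (\<gamma> * \<tau>)) powr (2 / \<gamma>))"
    have \<tau>: "0 < \<tau>" "\<tau> \<le> t" "\<tau> \<le> 1"
      using t by (auto simp: \<tau>_def)
    have "(\<integral>\<^sup>+v. ennreal (exp (a * (norm v)\<^sup>2)) \<partial>f t) \<le> ennreal (1 + E * M * a + C1)"
      using exp_moment_bound[OF \<tau> a(1)] a(2) by (simp add: mass C1_def E_def)
    also have "\<dots> \<le> ennreal (C * exp (C * T))"
    proof (rule ennreal_leI)
      have T: "0 \<le> T"
        by (simp add: T_def)
      have "(64 / (\<gamma> * \<tau>)) powr (2 / \<gamma>) = (64 / \<gamma>) powr (2 / \<gamma>) * \<tau> powr (- 2 / \<gamma>)"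
        using powr_mult[of "64 / \<gamma>" "1 / \<tau>" "2 / \<gamma>"] \<tau> assms
        by (simp add: powr_divide powr_minus_divide)
      moreover have "\<tau> powr (- 2 / \<gamma>) \<le> 1 + T"
        by (auto simp: \<tau>_def T_def min_def)
      ultimately have "a * (64 / (\<gamma> * \<tau>)) powr (2 / \<gamma>) \<le> \<beta> * (1 + T)"
        using mult_left_mono[of "\<tau> powr (- 2 / \<gamma>)" "1 + T" \<beta>] \<beta> by (simp add: \<beta>_def mult_ac)
      then have E_le: "E \<le> exp (1 + \<beta>) * exp (\<beta> * T)"
        by (simp add: E_def distrib_left add.assoc flip: exp_add)
      have E: "1 \<le> E"
        using a by (simp add: E_def)
      have "E * M * a \<le> E"
        using mult_left_mono[OF a(3), of E] E by (simp add: mult.assoc)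
      moreover have "C1 \<le> E * C1"
        using mult_right_mono[OF E C1] by simp
      moreover have "(2 + C1) * E = 2 * E + E * C1"
        by (simp add: algebra_simps)
      ultimately have "1 + E * M * a + C1 \<le> (2 + C1) * E"
        using E by linarith
      also have "\<dots> \<le> (2 + C1) * (exp (1 + \<beta>) * exp (\<beta> * T))"
        using E_le C1 by (intro mult_left_mono) auto
      also have "\<dots> = ((2 + C1) * exp (1 + \<beta>)) * exp (\<beta> * T)"
        by simp
      also have "\<dots> \<le> C * exp (C * T)"
        using C T by (intro mult_mono) (auto intro: mult_right_mono)
      finally show "1 + E * M * a + C1 \<le> C * exp (C * T)" .
    qed
    finally show ?thesis
      by (simp add: T_def)
  qed
  then show ?thesis
    using a C by blast
qed

end
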